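(* Let $\mathcal{G}^{(s)}=\{u\in\mathcal{F}_\mathrm{e}: \mathcal{E}(u,v)=0\text{ for all }v\in\mathcal{F}^{(s)}_\mathrm{e}\}$. Then $$\mathcal{G}^{(s)}=\{u\in\mathcal{F}_\mathrm{e}: u'\text{ is a.e. equal to a constant on }G\}.$$ If $m(G)=\infty$ (equivalently, $s(-\infty)=-\infty$ or $s(\infty)=\infty$), then $\mathcal{G}^{(s)}=\{u\in\mathcal{F}_\mathrm{e}:u'=0\text{ a.e. on }G\}$. Moreover, every $u\in\mathcal{F}_\mathrm{e}$ can be written as $u=u_1+u_2$ with $u_1\in\mathcal{F}^{(s)}_\mathrm{e}$ and $u_2\in\mathcal{G}^{(s)}$. This decomposition is unique if $(\mathcal{E}^{(s)},\mathcal{F}^{(s)})$ is transient (i.e. $s(-\infty)>-\infty$ or $s(\infty)<\infty$). It is unique up to an additive constant if $(\mathcal{E}^{(s)},\mathcal{F}^{(s)})$ is recurrent (i.e. $s(-\infty)=-\infty$ and $s(\infty)=\infty$).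
   Context: Let $m$ be Lebesgue measure. $(\mathcal{E},\mathcal{F})=(\frac12\mathbf{D},H^1(\mathbf{R}))$, $\mathcal{E}(u,v)=\frac12\int u'v'dx$, with extended space $\mathcal{F}_\mathrm{e}=\{u\text{ absolutely continuous},\ u'\in L^2(\mathbf{R})\}$, on which $\mathcal{E}$ is defined by the same formula. Let $s$ be strictly increasing, absolutely continuous, with $s'\in\{0,1\}$ a.e. Let $(\mathcal{E}^{(s)},\mathcal{F}^{(s)})$ be given by $\mathcal{F}^{(s)}=\{u\in L^2:u\ll s,\int(du/ds)^2ds<\infty\}$ and $\mathcal{E}^{(s)}(u,v)=\frac12\int\frac{du}{ds}\frac{dv}{ds}ds$, with extended space $\mathcal{F}^{(s)}_\mathrm{e}=\{u\ll s:\int(du/ds)^2ds<\infty,\ u(\infty)=0\text{ if }s(\infty)<\infty,\ u(-\infty)=0\text{ if }s(-\infty)>-\infty\}$. Let $G=\{s'=1\}$, $F=\mathbf{R}\setminus G$, and assume $G$ is open, $m(F)>0$ and $F$ has no isolated points. *)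

theory Defs
  imports "HOL-Analysis.Analysis"
begin

text \<open>Local absolute continuity of u with respect to an increasing function w on the
  whole real line: on every compact interval [a,b], for every eps > 0 there is delta > 0
  such that for every finite family of non-overlapping subintervals (x i, y i), i < n,
  of [a,b], sum (w (y i) - w (x i)) < delta implies sum abs (u (y i) - u (x i)) < eps.
  With w = id this is ordinary (local) absolute continuity; with w = s it is u << s.\<close>
definition abs_cont_wrt :: "(real \<Rightarrow> real) \<Rightarrow> (real \<Rightarrow> real) \<Rightarrow> bool" where
  "abs_cont_wrt w u \<longleftrightarrow>
     (\<forall>a b. \<forall>\<epsilon>>0. \<exists>\<delta>>0. \<forall>n x y.
        (\<forall>i<n. a \<le> x i \<and> x i \<le> y i \<and> y i \<le> b) \<and> (\<forall>i. Suc i < n \<longrightarrow> y i \<le> x (Suc i)) \<and>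
        (\<Sum>i<n. w (y i) - w (x i)) < \<delta>
        \<longrightarrow> (\<Sum>i<n. \<bar>u (y i) - u (x i)\<bar>) < \<epsilon>)"

text \<open>The extended Dirichlet space of (1/2 D, H^1(R)): absolutely continuous u with u' in L^2.\<close>
definition Fe :: "(real \<Rightarrow> real) set" where
  "Fe = {u. abs_cont_wrt id u \<and> deriv u \<in> borel_measurable lebesgue \<and>
            integrable lebesgue (\<lambda>x. (deriv u x)\<^sup>2)}"

definition energy :: "(real \<Rightarrow> real) \<Rightarrow> (real \<Rightarrow> real) \<Rightarrow> real" where
  "energy u v = 1/2 * (LINT x|lebesgue. deriv u x * deriv v x)"

definition is_ds_density :: "(real \<Rightarrow> real) \<Rightarrow> (real \<Rightarrow> real) \<Rightarrow> (real \<Rightarrow> real) \<Rightarrow> bool" where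
  "is_ds_density s u g \<longleftrightarrow> g \<in> borel_measurable borel \<and>
     (\<forall>a b. a \<le> b \<longrightarrow> set_integrable (interval_measure s) {a<..b} g \<and>
        u b - u a = (LINT x:{a<..b}|interval_measure s. g x))"

text \<open>Extended Dirichlet space of (E^(s), F^(s)).  s(\<infinity>) < \<infinity> is rendered as
  "s does not tend to +\<infinity> at +\<infinity>" (s is increasing), similarly at -\<infinity>.\<close>
definition Fse :: "(real \<Rightarrow> real) \<Rightarrow> (real \<Rightarrow> real) set" where
  "Fse s = {u. abs_cont_wrt s u \<and>
     (\<exists>g. is_ds_density s u g \<and> integrable (interval_measure s) (\<lambda>x. (g x)\<^sup>2)) \<and>
     (\<not> filterlim s at_top at_top \<longrightarrow> (u \<longlongrightarrow> 0) at_top) \<and>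
     (\<not> filterlim s at_bot at_bot \<longrightarrow> (u \<longlongrightarrow> 0) at_bot)}"

definition Gs :: "(real \<Rightarrow> real) \<Rightarrow> (real \<Rightarrow> real) set" where
  "Gs s = {u \<in> Fe. \<forall>v \<in> Fse s. energy u v = 0}"

definition s_transient :: "(real \<Rightarrow> real) \<Rightarrow> bool" where
  "s_transient s \<longleftrightarrow> \<not> filterlim s at_bot at_bot \<or> \<not> filterlim s at_top at_top"

definition s_recurrent :: "(real \<Rightarrow> real) \<Rightarrow> bool" where
  "s_recurrent s \<longleftrightarrow> filterlim s at_bot at_bot \<and> filterlim s at_top at_top"

end

(* The form restricted to G only sees v' = 1_G dv/ds, and dv/ds is an arbitrary element of
   L^2(ds) up to the boundary conditions. Subtracting from u in Fe the primitive of 1_G (u' - c)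
   leaves a function with derivative c on G; c = 0 if G has infinite measure, and c is the mean
   of u' over G otherwise, which makes the primitive vanish at both ends. Testing u in Gs against
   this primitive gives the integral of (u' - c)^2 over G, hence u' = c on G. Two decompositions
   differ by c s + d, and the boundary conditions at the ends where s is bounded kill c and d.
   Everything rests on the almost everywhere differentiability of an absolutely continuous u: its
   total variation V is absolutely continuous and monotone, so is V - u, and a monotone absolutely
   continuous function is a primitive of its Radon-Nikodym density. *)
theory Submission
  imports Defs
begin

section \<open>Total variation of absolutely continuous functions\<close>

text \<open>\<open>Fe\<close> prescribes absolute continuity and square integrability of
  \<open>deriv u\<close>, but \<open>deriv\<close> takes an unspecified value wherever u is not
  differentiable. So \<open>deriv (u - v) = deriv u - deriv v\<close>, on which both the existence
  and the uniqueness of the decomposition rest, is available only after genuine differentiability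
  almost everywhere has been established; that is the obstacle behind the first half. The second
  half lives on one coincidence. A nonzero constant is square integrable on G exactly when G has
  finite measure, which means that s is bounded at both ends, which in turn is when every element of
  \<open>Fse s\<close> must vanish at both ends. The constant c can therefore be nonzero only if all
  test functions have total increment 0, so it contributes no energy.\<close>

definition nonoverlapping :: "real \<Rightarrow> real \<Rightarrow> nat \<Rightarrow> (nat \<Rightarrow> real) \<Rightarrow> (nat \<Rightarrow> real) \<Rightarrow> bool" where
  "nonoverlapping a b n x y \<longleftrightarrow>
     (\<forall>i<n. a \<le> x i \<and> x i \<le> y i \<and> y i \<le> b) \<and> (\<forall>i. Suc i < n \<longrightarrow> y i \<le> x (Suc i))"

lemma abs_cont_wrt_alt:
  "abs_cont_wrt w u \<longleftrightarrow>
     (\<forall>a b. \<forall>\<epsilon>>0. \<exists>\<delta>>0. \<forall>n x y. nonoverlapping a b n x y \<longrightarrow>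
        (\<Sum>i<n. w (y i) - w (x i)) < \<delta> \<longrightarrow> (\<Sum>i<n. \<bar>u (y i) - u (x i)\<bar>) < \<epsilon>)"
  unfolding abs_cont_wrt_def nonoverlapping_def by (simp add: conj_assoc imp_conjL)

lemma abs_cont_wrtD:
  assumes "abs_cont_wrt w u" "\<epsilon> > 0"
  obtains \<delta> where "\<delta> > 0"
    "\<And>n x y. nonoverlapping a b n x y \<Longrightarrow> (\<Sum>i<n. w (y i) - w (x i)) < \<delta> \<Longrightarrow>
       (\<Sum>i<n. \<bar>u (y i) - u (x i)\<bar>) < \<epsilon>"
  using assms unfolding abs_cont_wrt_alt by metis

lemma nonoverlapping_le:
  assumes "nonoverlapping a b n x y" "i < j" "j < n"
  shows "y i \<le> x j"
  using assms(2,3)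
proof (induction j)
  case (Suc j)
  have *: "y j \<le> x (Suc j)" "x j \<le> y j"
    using assms(1) Suc.prems by (auto simp: nonoverlapping_def)
  show ?case
    using Suc * by (cases "i = j") auto
qed simp

text \<open>Without its last interval the family lives in [a, x n] and not merely in [a, b].
  Inductions on n therefore generalize over the right endpoint.\<close>

lemma nonoverlapping_SucD:
  assumes "nonoverlapping a b (Suc n) x y"
  shows "nonoverlapping a (x n) n x y" "a \<le> x n" "x n \<le> y n" "y n \<le> b"
proof -
  show "a \<le> x n" "x n \<le> y n" "y n \<le> b"
    using assms by (auto simp: nonoverlapping_def)
  have "y i \<le> x n" if "i < n" for i
    using nonoverlapping_le[OF assms that] by simp
  then show "nonoverlapping a (x n) n x y"
    using assms by (auto simp: nonoverlapping_def)
qed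

lemma nonoverlapping_map:
  assumes "nonoverlapping a b n x y" "mono f"
  shows "nonoverlapping (f a) (f b) n (\<lambda>i. f (x i)) (\<lambda>i. f (y i))"
  using assms by (auto simp: nonoverlapping_def mono_def)

lemma nonoverlapping_weaken:
  assumes "nonoverlapping a b n x y" "a' \<le> a" "b \<le> b'"
  shows "nonoverlapping a' b' n x y"
  using assms unfolding nonoverlapping_def by (meson order_trans)

text \<open>The gaps between consecutive intervals have nonnegative \<open>F\<close>-increments, so
  the sum is bounded by the telescoped one.\<close>

lemma nonoverlapping_sum_le:
  fixes F :: "real \<Rightarrow> real"
  assumes "nonoverlapping a b n x y" "a \<le> b" "mono F"
  shows "(\<Sum>i<n. F (y i) - F (x i)) \<le> F b - F a"
  using assms(1,2)
proof (induction n arbitrary: b)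
  case 0
  then show ?case using assms(3) by (simp add: mono_def)
next
  case (Suc n)
  note S = nonoverlapping_SucD[OF Suc.prems(1)]
  have "(\<Sum>i<n. F (y i) - F (x i)) \<le> F (x n) - F a"
    using Suc.IH[OF S(1,2)] .
  moreover have "F (y n) \<le> F b" using S assms(3) by (simp add: mono_def)
  ultimately show ?case by simp
qed

lemma nonoverlapping_append:
  assumes "nonoverlapping a c m p q" "nonoverlapping c b n x y" "a \<le> c" "c \<le> b"
  shows "nonoverlapping a b (m + n) (\<lambda>i. if i < m then p i else x (i - m)) (\<lambda>i. if i < m then q i else y (i - m))"
  unfolding nonoverlapping_def
proof (intro conjI allI impI)
  fix i assume "i < m + n"
  with assms show "a \<le> (if i < m then p i else x (i - m))"
    "(if i < m then p i else x (i - m)) \<le> (if i < m then q i else y (i - m))"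
    "(if i < m then q i else y (i - m)) \<le> b"
    by (auto simp: nonoverlapping_def intro: order_trans)
next
  fix i assume i: "Suc i < m + n"
  consider "Suc i < m" | "Suc i = m" | "i \<ge> m" by linarith
  then show "(if i < m then q i else y (i - m)) \<le> (if Suc i < m then p (Suc i) else x (Suc i - m))"
  proof cases
    case 2
    then have "q i \<le> c" "c \<le> x 0" using assms i by (auto simp: nonoverlapping_def)
    then show ?thesis using 2 by auto
  next
    case 3
    then have "Suc (i - m) < n" using i by auto
    then have "y (i - m) \<le> x (Suc (i - m))" using assms by (auto simp: nonoverlapping_def)
    then show ?thesis using 3 by (simp add: Suc_diff_le)
  qed (use assms in \<open>auto simp: nonoverlapping_def\<close>)
qed

text \<open>Kept general in \<open>\<phi>\<close> because the same concatenated family is measured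
  both by length and by increments of u.\<close>

lemma sum_append:
  fixes \<phi> :: "real \<Rightarrow> real \<Rightarrow> real" and m n :: nat
  shows "(\<Sum>i<m + n. \<phi> (if i < m then p i else x (i - m)) (if i < m then q i else y (i - m))) =
    (\<Sum>i<m. \<phi> (p i) (q i)) + (\<Sum>i<n. \<phi> (x i) (y i))"
proof -
  have "(\<Sum>i<m + n. \<phi> (if i < m then p i else x (i - m)) (if i < m then q i else y (i - m))) =
    (\<Sum>i<m. \<phi> (p i) (q i)) + (\<Sum>i = m..<m + n. \<phi> (x (i - m)) (y (i - m)))"
    by (subst sum.atLeastLessThan_concat[of 0 m "m + n", symmetric, unfolded lessThan_atLeast0[symmetric]])
       (auto intro!: arg_cong2[where f="(+)"] sum.cong)
  also have "(\<Sum>i = m..<m + n. \<phi> (x (i - m)) (y (i - m))) = (\<Sum>i<n. \<phi> (x i) (y i))"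
    using sum.shift_bounds_nat_ivl[of "\<lambda>i. \<phi> (x (i - m)) (y (i - m))" 0 m n]
    by (simp add: lessThan_atLeast0 add.commute)
  finally show ?thesis .
qed

text \<open>If c lies between p and q this is the triangle inequality through \<open>u c\<close>;
  otherwise one of the two terms on the right is 0.\<close>

lemma abs_diff_clamp:
  fixes u :: "real \<Rightarrow> real"
  assumes "p \<le> q"
  shows "\<bar>u q - u p\<bar> \<le> \<bar>u (min q c) - u (min p c)\<bar> + \<bar>u (max q c) - u (max p c)\<bar>"
  using assms by (auto simp: min_def max_def)

lemma sum_abs_diff_clamp:
  fixes u :: "real \<Rightarrow> real"
  assumes "nonoverlapping a b n x y" "a \<le> c" "c \<le> b"
  obtains x1 y1 x2 y2 where "nonoverlapping a c n x1 y1" "nonoverlapping c b n x2 y2"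
    "(\<Sum>i<n. \<bar>u (y i) - u (x i)\<bar>) \<le> (\<Sum>i<n. \<bar>u (y1 i) - u (x1 i)\<bar>) + (\<Sum>i<n. \<bar>u (y2 i) - u (x2 i)\<bar>)"
proof
  show "nonoverlapping a c n (\<lambda>i. min (x i) c) (\<lambda>i. min (y i) c)"
    using nonoverlapping_map[OF assms(1) monoI, of "\<lambda>t. min t c"] assms(2,3)
    by (simp add: min_absorb1 min_absorb2 min.coboundedI1)
  show "nonoverlapping c b n (\<lambda>i. max (x i) c) (\<lambda>i. max (y i) c)"
    using nonoverlapping_map[OF assms(1) monoI, of "\<lambda>t. max t c"] assms(2,3)
    by (simp add: max_absorb1 max_absorb2 max.coboundedI1)
  show "(\<Sum>i<n. \<bar>u (y i) - u (x i)\<bar>) \<le> (\<Sum>i<n. \<bar>u (min (y i) c) - u (min (x i) c)\<bar>) + (\<Sum>i<n. \<bar>u (max (y i) c) - u (max (x i) c)\<bar>)"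
    unfolding sum.distrib[symmetric]
    by (intro sum_mono abs_diff_clamp) (use assms(1) in \<open>auto simp: nonoverlapping_def\<close>)
qed

section \<open>The variation function: finiteness, additivity, absolute continuity\<close>

definition total_variation :: "(real \<Rightarrow> real) \<Rightarrow> real \<Rightarrow> real \<Rightarrow> real" where
  "total_variation u a b = Sup {(\<Sum>i<n. \<bar>u (y i) - u (x i)\<bar>) |n x y. nonoverlapping a b n x y}"

text \<open>Cut [a, b] into pieces of length at most \<open>\<delta> / 2\<close>; on each piece
  every family has variation below 1, so the number of pieces is a bound. This makes the real
  supremum in \<open>total_variation\<close> meaningful.\<close>

lemma abs_cont_variation_bounded:
  assumes "abs_cont_wrt id u"
  shows "\<exists>M. \<forall>n x y. nonoverlapping a b n x y \<longrightarrow> (\<Sum>i<n. \<bar>u (y i) - u (x i)\<bar>) \<le> M"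
proof -
  obtain \<delta> where \<delta>: "\<delta> > 0" "\<And>n x y. nonoverlapping a b n x y \<Longrightarrow> (\<Sum>i<n. id (y i) - id (x i)) < \<delta> \<Longrightarrow>
       (\<Sum>i<n. \<bar>u (y i) - u (x i)\<bar>) < 1"
    using abs_cont_wrtD[OF assms, of 1 a b] by auto
  have step: "(\<Sum>i<n. \<bar>u (y i) - u (x i)\<bar>) \<le> real k"
    if "nonoverlapping a c n x y" "a \<le> c" "c \<le> b" "c \<le> a + real k * (\<delta> / 2)" for k c n x y
    using that
  proof (induction k arbitrary: c x y)
    case 0
    then have "c = a" by simp
    then have "x i = a \<and> y i = a" if "i < n" for i
      using 0(1) that unfolding nonoverlapping_def by (meson order.antisym order_trans)
    then show ?case by simp
  next
    case (Suc k)
    \<comment> \<open>The last piece is [d, c]. Half of \<open>\<delta>\<close> leaves room for the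
      strict inequality, and the maximum keeps the cut point inside [a, c].\<close>
    define d where "d = max a (c - \<delta> / 2)"
    have d: "a \<le> d" "d \<le> c" "d \<le> a + real k * (\<delta> / 2)" "c - d \<le> \<delta> / 2"
      using Suc.prems \<delta>(1) unfolding d_def by (auto simp: field_simps max_def split: if_splits)
    obtain x1 y1 x2 y2 where *: "nonoverlapping a d n x1 y1" "nonoverlapping d c n x2 y2"
      "(\<Sum>i<n. \<bar>u (y i) - u (x i)\<bar>) \<le> (\<Sum>i<n. \<bar>u (y1 i) - u (x1 i)\<bar>) + (\<Sum>i<n. \<bar>u (y2 i) - u (x2 i)\<bar>)"
      using sum_abs_diff_clamp[OF Suc.prems(1) d(1,2)] by blast
    have "(\<Sum>i<n. \<bar>u (y1 i) - u (x1 i)\<bar>) \<le> k"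
      using Suc.IH[OF *(1) d(1) _ d(3)] d(2) Suc.prems(3) by simp
    moreover have "(\<Sum>i<n. id (y2 i) - id (x2 i)) \<le> id c - id d"
      by (rule nonoverlapping_sum_le[OF *(2)]) (use d in \<open>auto simp: mono_def\<close>)
    then have "(\<Sum>i<n. \<bar>u (y2 i) - u (x2 i)\<bar>) < 1"
      by (intro \<delta>(2)) (use d \<delta>(1) Suc.prems(3) nonoverlapping_weaken[OF *(2)] in auto)
    ultimately show ?case using *(3) by simp
  qed
  obtain k :: nat where k: "(b - a) / (\<delta> / 2) \<le> real k" using real_arch_simple by blast
  have "b \<le> a + real k * (\<delta> / 2)" using k \<delta>(1) by (simp add: field_simps)
  then have "(\<Sum>i<n. \<bar>u (y i) - u (x i)\<bar>) \<le> real k" if "nonoverlapping a b n x y" for n x y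
  proof (cases "a \<le> b")
    \<comment> \<open>An empty interval admits only the empty family.\<close>
    case False
    then have "n = 0" using that unfolding nonoverlapping_def by (meson gr_zeroI order_trans)
    then show ?thesis by simp
  qed (use step[OF that] in auto)
  then show ?thesis by blast
qed

context
  fixes u :: "real \<Rightarrow> real"
  assumes ac: "abs_cont_wrt id u"
begin

lemma variation_bdd_above:
  "bdd_above {(\<Sum>i<n. \<bar>u (y i) - u (x i)\<bar>) |n x y. nonoverlapping a b n x y}"
  using abs_cont_variation_bounded[OF ac, of a b] by (fastforce simp: bdd_above_def)

lemma sum_le_total_variation:
  assumes "nonoverlapping a b n x y"
  shows "(\<Sum>i<n. \<bar>u (y i) - u (x i)\<bar>) \<le> total_variation u a b"
  unfolding total_variation_def by (rule cSup_upper[OF _ variation_bdd_above]) (use assms in blast)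

lemma total_variation_least:
  assumes "\<And>n x y. nonoverlapping a b n x y \<Longrightarrow> (\<Sum>i<n. \<bar>u (y i) - u (x i)\<bar>) \<le> M"
  shows "total_variation u a b \<le> M"
  unfolding total_variation_def
proof (rule cSup_least)
  have "nonoverlapping a b 0 (\<lambda>_. 0) (\<lambda>_. 0)" by (simp add: nonoverlapping_def)
  then show "{(\<Sum>i<n. \<bar>u (y i) - u (x i)\<bar>) |n x y. nonoverlapping a b n x y} \<noteq> {}" by blast
qed (use assms in blast)

lemma total_variation_approx:
  assumes "\<eta> > 0"
  obtains n x y where "nonoverlapping a b n x y" "total_variation u a b - \<eta> < (\<Sum>i<n. \<bar>u (y i) - u (x i)\<bar>)"
  using total_variation_least[of a b "total_variation u a b - \<eta>"] assms by (meson diff_gt_0_iff_gt diff_less_eq less_add_same_cancel1 linorder_not_le)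

text \<open>Append [x, y] to a family in [a, x]. The absolute value makes this one inequality yield
  the monotonicity of both V and V - u.\<close>

lemma total_variation_superadd:
  assumes "a \<le> x" "x \<le> y"
  shows "total_variation u a x + \<bar>u y - u x\<bar> \<le> total_variation u a y"
proof -
  have "total_variation u a x \<le> total_variation u a y - \<bar>u y - u x\<bar>"
  proof (rule total_variation_least)
    fix n p q assume p: "nonoverlapping a x n p q"
    have 1: "nonoverlapping x y 1 (\<lambda>_. x) (\<lambda>_. y)" using assms by (auto simp: nonoverlapping_def)
    have "(\<Sum>i<n. \<bar>u (q i) - u (p i)\<bar>) + (\<Sum>i<(1::nat). \<bar>u y - u x\<bar>) \<le> total_variation u a y"
      using sum_le_total_variation[OF nonoverlapping_append[OF p 1 assms]]
        sum_append[where \<phi>="\<lambda>s t. \<bar>u t - u s\<bar>" and m=n and n=1 and p=p and x="\<lambda>_. x" and q=q and y="\<lambda>_. y"] by simp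
    then show "(\<Sum>i<n. \<bar>u (q i) - u (p i)\<bar>) \<le> total_variation u a y - \<bar>u y - u x\<bar>" by simp
  qed
  then show ?thesis by simp
qed

lemma total_variation_subadd:
  assumes "a \<le> x" "x \<le> y"
  shows "total_variation u a y \<le> total_variation u a x + total_variation u x y"
proof (rule total_variation_least)
  fix n p q assume "nonoverlapping a y n p q"
  from sum_abs_diff_clamp[OF this assms] obtain x1 y1 x2 y2 where
    "nonoverlapping a x n x1 y1" "nonoverlapping x y n x2 y2"
    "(\<Sum>i<n. \<bar>u (q i) - u (p i)\<bar>) \<le> (\<Sum>i<n. \<bar>u (y1 i) - u (x1 i)\<bar>) + (\<Sum>i<n. \<bar>u (y2 i) - u (x2 i)\<bar>)" .
  then show "(\<Sum>i<n. \<bar>u (q i) - u (p i)\<bar>) \<le> total_variation u a x + total_variation u x y"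
    using sum_le_total_variation by (meson add_mono order_trans)
qed

text \<open>Nearly optimal families inside the given intervals are strung together, at a loss of
  \<open>\<eta>\<close> each. The total length does not grow, so a \<open>\<delta>\<close> that
  works for u also controls the sum of the variations.\<close>

lemma total_variation_concat:
  assumes "nonoverlapping a b n x y" "a \<le> b" "\<eta> > 0"
  shows "\<exists>m p q. nonoverlapping a b m p q \<and> (\<Sum>i<m. q i - p i) \<le> (\<Sum>i<n. y i - x i) \<and>
     (\<Sum>i<n. total_variation u (x i) (y i)) - real n * \<eta> \<le> (\<Sum>i<m. \<bar>u (q i) - u (p i)\<bar>)"
  using assms(1,2)
proof (induction n arbitrary: b)
  case 0
  show ?case by (rule exI[of _ 0]) (simp add: nonoverlapping_def)
next
  case (Suc n)
  note S = nonoverlapping_SucD[OF Suc.prems(1)]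
  obtain m p q where 1: "nonoverlapping a (x n) m p q" "(\<Sum>i<m. q i - p i) \<le> (\<Sum>i<n. y i - x i)"
     "(\<Sum>i<n. total_variation u (x i) (y i)) - real n * \<eta> \<le> (\<Sum>i<m. \<bar>u (q i) - u (p i)\<bar>)"
    using Suc.IH[OF S(1,2)] by blast
  obtain m' p' q' where 2: "nonoverlapping (x n) (y n) m' p' q'"
     "total_variation u (x n) (y n) - \<eta> < (\<Sum>i<m'. \<bar>u (q' i) - u (p' i)\<bar>)"
    using total_variation_approx[OF assms(3)] by blast
  have 3: "nonoverlapping (x n) b m' p' q'" using nonoverlapping_weaken[OF 2(1)] S by simp
  have 4: "(\<Sum>i<m'. q' i - p' i) \<le> y n - x n"
    using nonoverlapping_sum_le[OF 2(1) S(3), of "\<lambda>t. t"] by (simp add: mono_def)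
  show ?case
    apply (intro exI conjI)
      apply (rule nonoverlapping_append[OF 1(1) 3])
    subgoal using S by simp
    subgoal using S by simp
    subgoal using 1(2) 4 by (simp add: sum_append[where \<phi>="\<lambda>s t. t - s"])
    subgoal using 1(3) 2(2) by (simp add: sum_append[where \<phi>="\<lambda>s t. \<bar>u t - u s\<bar>"] distrib_right)
    done
qed

text \<open>The clamp \<open>max a x\<close> freezes the variation to the left of a, which gives a
  function on the whole line to which the additivity lemmas, stated for points right of a, still
  apply.\<close>

lemma abs_cont_total_variation: "abs_cont_wrt id (\<lambda>x. total_variation u a (max a x))"
  unfolding abs_cont_wrt_alt
proof (intro allI impI)
  fix c d \<epsilon> :: real assume "\<epsilon> > 0"
  then obtain \<delta> where \<delta>: "\<delta> > 0" "\<And>n x y. nonoverlapping c d n x y \<Longrightarrow> (\<Sum>i<n. id (y i) - id (x i)) < \<delta> \<Longrightarrow>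
       (\<Sum>i<n. \<bar>u (y i) - u (x i)\<bar>) < \<epsilon> / 2"
    using abs_cont_wrtD[OF ac, of "\<epsilon> / 2" c d] by auto
  have "(\<Sum>i<n. \<bar>total_variation u a (max a (y i)) - total_variation u a (max a (x i))\<bar>) < \<epsilon>"
    if fam: "nonoverlapping c d n x y" "(\<Sum>i<n. id (y i) - id (x i)) < \<delta>" for n x y
  proof (cases "n = 0")
    case False
    then have cd: "c \<le> d" using fam(1) by (auto simp: nonoverlapping_def dest!: spec[of _ 0])
    have xy: "x i \<le> y i" if "i < n" for i using fam(1) that by (auto simp: nonoverlapping_def)
    \<comment> \<open>Chosen so that the n losses of the concatenation add up to
      \<open>\<epsilon> / 2\<close>.\<close>
    define \<eta> where "\<eta> = \<epsilon> / (2 * real n)"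
    have "\<eta> > 0" using False \<open>\<epsilon> > 0\<close> by (simp add: \<eta>_def)
    have le: "\<bar>total_variation u a (max a (y i)) - total_variation u a (max a (x i))\<bar> \<le> total_variation u (x i) (y i)"
      if "i < n" for i
    proof -
      have "total_variation u a (max a (x i)) \<le> total_variation u a (max a (y i))"
        using total_variation_superadd[of a "max a (x i)" "max a (y i)"] xy[OF that] by (auto simp: max_def split: if_splits)
      moreover have "total_variation u a (max a (y i)) \<le> total_variation u a (max a (x i)) + total_variation u (max a (x i)) (max a (y i))"
        using total_variation_subadd[of a "max a (x i)" "max a (y i)"] xy[OF that] by (auto simp: max_def)
      moreover have "total_variation u (max a (x i)) (max a (y i)) \<le> total_variation u (x i) (y i)"
      \<comment> \<open>If y i reaches a, the clamped interval is contained in the original one.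
        Otherwise both clamped endpoints equal a, where the variation is 0.\<close>
      proof (cases "a \<le> y i")
        case True
        show ?thesis
          by (rule total_variation_least, rule sum_le_total_variation, erule nonoverlapping_weaken) (use True xy[OF that] in auto)
      next
        case False
        have "total_variation u a a \<le> 0"
        proof (rule total_variation_least)
          fix n p q assume "nonoverlapping a a n p q"
          then have "p i = a \<and> q i = a" if "i < n" for i
            using that unfolding nonoverlapping_def by (meson order.antisym order_trans)
          then show "(\<Sum>i<n. \<bar>u (q i) - u (p i)\<bar>) \<le> 0" by simp
        qed
        also have "0 \<le> total_variation u (x i) (y i)"
          using sum_le_total_variation[of "x i" "y i" 0] by (simp add: nonoverlapping_def)
        finally show ?thesis using False xy[OF that] by (simp add: max_def)
      qed
      ultimately show ?thesis by linarith
    qed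
    obtain m p q where m: "nonoverlapping c d m p q" "(\<Sum>i<m. q i - p i) \<le> (\<Sum>i<n. y i - x i)"
      "(\<Sum>i<n. total_variation u (x i) (y i)) - real n * \<eta> \<le> (\<Sum>i<m. \<bar>u (q i) - u (p i)\<bar>)"
      using total_variation_concat[OF fam(1) cd \<open>\<eta> > 0\<close>] by blast
    have "(\<Sum>i<m. \<bar>u (q i) - u (p i)\<bar>) < \<epsilon> / 2"
      by (rule \<delta>(2)[OF m(1)]) (use m(2) fam(2) in simp)
    moreover have "(\<Sum>i<n. \<bar>total_variation u a (max a (y i)) - total_variation u a (max a (x i))\<bar>) \<le> (\<Sum>i<n. total_variation u (x i) (y i))"
      by (rule sum_mono) (use le in simp)
    moreover have "real n * \<eta> = \<epsilon> / 2" using False by (simp add: \<eta>_def)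
    ultimately show ?thesis using m(3) by linarith
  qed (use \<open>\<epsilon> > 0\<close> in simp)
  with \<delta>(1) show "\<exists>\<delta>>0. \<forall>n x y. nonoverlapping c d n x y \<longrightarrow> (\<Sum>i<n. id (y i) - id (x i)) < \<delta> \<longrightarrow>
     (\<Sum>i<n. \<bar>total_variation u a (max a (y i)) - total_variation u a (max a (x i))\<bar>) < \<epsilon>" by blast
qed

end

section \<open>Almost everywhere differentiability\<close>

text \<open>Bridges a covering by an unordered set of intervals and the ordered lists of
  \<open>abs_cont_wrt\<close>: peel off the interval with the largest left endpoint, since all
  others lie to its left. The quantifier over \<open>\<phi>\<close> lets one list serve for lengths
  and for increments of W.\<close>

lemma sort_nonoverlapping:
  fixes P :: "real set set"
  assumes "finite P" "\<And>K. K \<in> P \<Longrightarrow> \<exists>c d. K = {c..d} \<and> a \<le> c \<and> c < d \<and> d \<le> b"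
    "pairwise (\<lambda>A B. interior A \<inter> interior B = {}) P"
  shows "\<exists>n x y. nonoverlapping a b n x y \<and>
    (\<forall>\<phi> :: real \<Rightarrow> real \<Rightarrow> real. (\<Sum>K\<in>P. \<phi> (Inf K) (Sup K)) = (\<Sum>i<n. \<phi> (x i) (y i)))"
  using assms
proof (induction "card P" arbitrary: P b)
  case 0
  then show ?case by (intro exI[of _ 0]) (auto simp: nonoverlapping_def)
next
  case (Suc m)
  have "Inf ` P \<noteq> {}" using Suc.hyps(2) by auto
  then obtain K where K: "K \<in> P" "Inf K = Max (Inf ` P)"
    using Max_in[of "Inf ` P"] Suc.prems(1) by (metis finite_imageI imageE)
  then have Kmax: "Inf L \<le> Inf K" if "L \<in> P" for L
    using Suc.prems(1) that by simp
  obtain c d where cd: "K = {c..d}" "a \<le> c" "c < d" "d \<le> b" using Suc.prems(2)[OF K(1)] by blast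
  have sub: "\<exists>c' d'. L = {c'..d'} \<and> a \<le> c' \<and> c' < d' \<and> d' \<le> c" if L: "L \<in> P - {K}" for L
  proof -
    obtain c' d' where L': "L = {c'..d'}" "a \<le> c'" "c' < d'" "d' \<le> b" using Suc.prems(2) L by blast
    have "c' \<le> c" using Kmax[of L] L L' cd by simp
    moreover have "interior L \<inter> interior K = {}" using Suc.prems(3) L K(1) by (auto simp: pairwise_def)
    then have "{c'<..<d'} \<inter> {c<..<d} = {}" by (simp add: L' cd interior_atLeastAtMost_real)
    \<comment> \<open>If d' were larger than c, a point strictly between c and
      \<open>min d d'\<close> would be interior to both intervals.\<close>
    then have "d' \<le> c" using \<open>c' \<le> c\<close> L'(3) cd(3) dense[of c "min d d'"]
      by (fastforce simp: min_def not_le split: if_splits)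
    ultimately show ?thesis using L' by blast
  qed
  have "m = card (P - {K})" using Suc.hyps(2) K(1) Suc.prems(1) by simp
  moreover have "finite (P - {K})" using Suc.prems(1) by simp
  moreover have "pairwise (\<lambda>A B. interior A \<inter> interior B = {}) (P - {K})"
    using Suc.prems(3) by (rule pairwise_subset) simp
  ultimately have "\<exists>n x y. nonoverlapping a c n x y \<and>
    (\<forall>\<phi> :: real \<Rightarrow> real \<Rightarrow> real. (\<Sum>K\<in>P - {K}. \<phi> (Inf K) (Sup K)) = (\<Sum>i<n. \<phi> (x i) (y i)))"
    using sub by (intro Suc.hyps(1))
  then obtain n x y where
    n: "nonoverlapping a c n x y" "\<And>\<phi> :: real \<Rightarrow> real \<Rightarrow> real. (\<Sum>K\<in>P - {K}. \<phi> (Inf K) (Sup K)) = (\<Sum>i<n. \<phi> (x i) (y i))"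
    by blast
  have 1: "nonoverlapping c b 1 (\<lambda>_. c) (\<lambda>_. d)" using cd by (auto simp: nonoverlapping_def)
  show ?case
  proof (intro exI conjI allI)
    show "nonoverlapping a b (n + 1) (\<lambda>i. if i < n then x i else c) (\<lambda>i. if i < n then y i else d)"
      using nonoverlapping_append[OF n(1) 1] cd by simp
    fix \<phi> :: "real \<Rightarrow> real \<Rightarrow> real"
    have "(\<Sum>L\<in>P. \<phi> (Inf L) (Sup L)) = \<phi> c d + (\<Sum>L\<in>P - {K}. \<phi> (Inf L) (Sup L))"
      using sum.remove[OF Suc.prems(1) K(1), of "\<lambda>L. \<phi> (Inf L) (Sup L)"] cd by simp
    then show "(\<Sum>L\<in>P. \<phi> (Inf L) (Sup L)) = (\<Sum>i<n + 1. \<phi> (if i < n then x i else c) (if i < n then y i else d))"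
      using n(2)[of \<phi>] by simp
  qed
qed

section \<open>Lebesgue densities of monotone absolutely continuous functions\<close>

lemma abs_cont_continuous:
  assumes "abs_cont_wrt id u"
  shows "continuous_on UNIV u"
proof (clarsimp simp: continuous_on_iff)
  fix x e :: real assume "e > 0"
  from abs_cont_wrtD[OF assms this, of "x - 1" "x + 1"]
  obtain \<delta> where \<delta>: "\<delta> > 0" "\<And>n p q. nonoverlapping (x - 1) (x + 1) n p q \<Longrightarrow> (\<Sum>i<n. id (q i) - id (p i)) < \<delta> \<Longrightarrow>
       (\<Sum>i<n. \<bar>u (q i) - u (p i)\<bar>) < e" by blast
  have "dist (u y) (u x) < e" if "dist y x < min 1 \<delta>" for y
  proof -
    have "\<bar>u (max x y) - u (min x y)\<bar> < e"
      using \<delta>(2)[of 1 "\<lambda>_. min x y" "\<lambda>_. max x y"] that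
      by (simp add: nonoverlapping_def dist_real_def) linarith
    then show ?thesis by (simp add: dist_real_def min_def max_def abs_minus_commute split: if_splits)
  qed
  then show "\<exists>d>0. \<forall>y. dist y x < d \<longrightarrow> dist (u y) (u x) < e"
    using \<delta>(1) by (intro exI[of _ "min 1 \<delta>"]) auto
qed

lemma abs_cont_right_continuous:
  assumes "abs_cont_wrt id W"
  shows "continuous (at_right a) W"
  using abs_cont_continuous[OF assms]
  by (meson UNIV_I continuous_on_eq_continuous_within continuous_within_subset subset_UNIV)

text \<open>Cover N by countably many nonoverlapping intervals of total length below
  \<open>\<delta>\<close>. Absolute continuity speaks of finite families only, so it bounds the
  measure of finite subunions, and continuity from below carries the bound to the whole
  cover.\<close>

lemma interval_measure_abs_cont_null_bounded:
  assumes ac: "abs_cont_wrt id W" and mono: "mono W" and N: "N \<in> null_sets lborel" "N \<subseteq> {a..b}" and ab: "a < b"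
  shows "emeasure (interval_measure W) N = 0"
proof -
  let ?\<nu> = "interval_measure W"
  have mono': "\<And>x y. x \<le> y \<Longrightarrow> W x \<le> W y" using mono by (simp add: mono_def)
  have "emeasure ?\<nu> N \<le> ennreal \<epsilon>" if "\<epsilon> > 0" for \<epsilon>
  proof -
    obtain \<delta> where \<delta>: "\<delta> > 0" "\<And>n x y. nonoverlapping a b n x y \<Longrightarrow> (\<Sum>i<n. id (y i) - id (x i)) < \<delta> \<Longrightarrow>
       (\<Sum>i<n. \<bar>W (y i) - W (x i)\<bar>) < \<epsilon>"
      using abs_cont_wrtD[OF ac \<open>\<epsilon> > 0\<close>, of a b] by blast
    have neg: "negligible N" using N(1) by (simp add: negligible_iff_null_sets null_sets_completionI)
    have Nl: "N \<in> lmeasurable" "measure lebesgue N = 0"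
      using neg by (auto simp: negligible_iff_measure)
    \<comment> \<open>The excess \<open>\<delta> / 2\<close> keeps the length of the cover strictly
      below \<open>\<delta>\<close>.\<close>
    have "N \<subseteq> cbox a b" "\<delta> / 2 > 0" using N \<delta> by auto
    from measurable_outer_intervals_bounded[OF Nl(1) this] obtain \<D> where
      D: "countable \<D>" "\<And>K. K \<in> \<D> \<Longrightarrow> K \<subseteq> cbox a b \<and> K \<noteq> {} \<and> (\<exists>c d. K = cbox c d)"
        "pairwise (\<lambda>A B. interior A \<inter> interior B = {}) \<D>"
        "\<And>K. \<lbrakk>K \<in> \<D>; box a b \<noteq> {}\<rbrakk> \<Longrightarrow> interior K \<noteq> {}"
        "N \<subseteq> \<Union>\<D>" "\<Union>\<D> \<in> lmeasurable" "measure lebesgue (\<Union>\<D>) \<le> measure lebesgue N + \<delta> / 2"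
      by metis
    have K: "\<exists>c d. K = {c..d} \<and> a \<le> c \<and> c < d \<and> d \<le> b" if KD: "K \<in> \<D>" for K
    proof -
      obtain c d where "K = {c..d}" "K \<subseteq> {a..b}" "K \<noteq> {}" using D(2)[OF KD] by auto
      moreover have "interior K \<noteq> {}" using D(4)[OF KD] ab by simp
      ultimately show ?thesis by (auto simp: interior_atLeastAtMost_real)
    qed
    have fin: "emeasure ?\<nu> (\<Union>P) \<le> ennreal \<epsilon>" if P: "finite P" "P \<subseteq> \<D>" for P
    proof -
      have K': "\<And>K. K \<in> P \<Longrightarrow> \<exists>c d. K = {c..d} \<and> a \<le> c \<and> c < d \<and> d \<le> b" using K P by blast
      have pw: "pairwise (\<lambda>A B. interior A \<inter> interior B = {}) P" using D(3) P(2) by (rule pairwise_subset)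
      have "\<exists>n x y. nonoverlapping a b n x y \<and>
        (\<forall>\<phi> :: real \<Rightarrow> real \<Rightarrow> real. (\<Sum>K\<in>P. \<phi> (Inf K) (Sup K)) = (\<Sum>i<n. \<phi> (x i) (y i)))"
        by (rule sort_nonoverlapping[OF P(1) _ pw]) (rule K')
      then obtain n x y where n: "nonoverlapping a b n x y"
        "\<forall>\<phi> :: real \<Rightarrow> real \<Rightarrow> real. (\<Sum>K\<in>P. \<phi> (Inf K) (Sup K)) = (\<Sum>i<n. \<phi> (x i) (y i))"
        by (elim exE conjE)
      have div: "P division_of \<Union>P"
        unfolding division_of_def
      proof (intro conjI ballI impI)
        fix K assume "K \<in> P"
        from K'[OF this] obtain c d where "K = {c..d}" "c < d" by blast
        then show "\<exists>a b. K = cbox a b" "K \<noteq> {}" by auto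
        show "K \<subseteq> \<Union>P" using \<open>K \<in> P\<close> by blast
      next
        fix K L assume "K \<in> P" "L \<in> P" "K \<noteq> L"
        then show "interior K \<inter> interior L = {}" by (rule pairwiseD[OF pw])
      qed (rule P refl)+
      have "(\<Sum>i<n. id (y i) - id (x i)) = (\<Sum>K\<in>P. Sup K - Inf K)" using n(2)[THEN spec, of "\<lambda>s t. t - s"] by simp
      also have "\<dots> = (\<Sum>K\<in>P. measure lebesgue K)"
      proof (rule sum.cong)
        fix L assume "L \<in> P"
        from K'[OF this] obtain c d where "L = {c..d}" "c < d" by blast
        then show "Sup L - Inf L = measure lebesgue L" by simp
      qed simp
      also have "\<dots> = measure lebesgue (\<Union>P)" using content_division[OF div] by simp
      also have "\<dots> \<le> measure lebesgue (\<Union>\<D>)"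
      proof (rule measure_mono_fmeasurable)
        show "\<Union>P \<subseteq> \<Union>\<D>" using P(2) by blast
        show "\<Union>P \<in> sets lebesgue"
          using division_of_finite[OF div] div by (intro sets.finite_Union) auto
      qed (fact D(6))
      also have "\<dots> < \<delta>" using D(7) Nl(2) \<delta>(1) by simp
      finally have "(\<Sum>i<n. \<bar>W (y i) - W (x i)\<bar>) < \<epsilon>" using \<delta>(2)[OF n(1)] by simp
      then have "(\<Sum>K\<in>P. \<bar>W (Sup K) - W (Inf K)\<bar>) < \<epsilon>" using n(2)[THEN spec, of "\<lambda>s t. \<bar>W t - W s\<bar>"] by simp
      \<comment> \<open>W is continuous, so points carry no mass and closed intervals have the
        measure of half-open ones.\<close>
      moreover have "(\<Sum>K\<in>P. emeasure ?\<nu> K) = (\<Sum>K\<in>P. ennreal \<bar>W (Sup K) - W (Inf K)\<bar>)"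
      proof (rule sum.cong)
        fix L assume "L \<in> P"
        from K'[OF this] obtain c d where "L = {c..d}" "c < d" by blast
        then show "emeasure ?\<nu> L = ennreal \<bar>W (Sup L) - W (Inf L)\<bar>"
          using emeasure_interval_measure_Icc[of c d W] mono' abs_cont_continuous[OF ac] by simp
      qed simp
      moreover have "emeasure ?\<nu> (\<Union>K\<in>P. K) \<le> (\<Sum>K\<in>P. emeasure ?\<nu> K)"
        using P(1)
      proof (rule emeasure_subadditive_finite)
        show "(\<lambda>K. K) ` P \<subseteq> sets ?\<nu>"
        proof safe
          fix L assume "L \<in> P"
          from K'[OF this] obtain c d where "L = {c..d}" by blast
          then show "L \<in> sets ?\<nu>" by simp
        qed
      qed
      ultimately show ?thesis
        by (simp add: sum_ennreal) (meson ennreal_leI less_imp_le order_trans)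
    qed
    show ?thesis
    proof (cases "\<D> = {}")
      case True
      then have "N = {}" using D(5) by blast
      then show ?thesis by simp
    next
      case False
      let ?f = "from_nat_into \<D>"
      have r: "range ?f = \<D>" using False D(1) by (rule range_from_nat_into)
      have D_sets: "L \<in> sets ?\<nu>" if "L \<in> \<D>" for L
      proof -
        from K[OF that] obtain c d where "L = {c..d}" by blast
        then show ?thesis by simp
      qed
      have f_sets: "?f i \<in> sets ?\<nu>" for i
        by (rule D_sets[OF from_nat_into[OF False]])
      define B where "B m = (\<Union>i<m. ?f i)" for m
      have U: "(\<Union>m. B m) = \<Union>\<D>"
      proof -
        have "(\<Union>m. B m) = \<Union>(range ?f)" unfolding B_def by auto
        then show ?thesis by (simp only: r)
      qed
      have Bsets: "B m \<in> sets ?\<nu>" for m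
        unfolding B_def by (rule sets.finite_UN) (use f_sets in auto)
      have "emeasure ?\<nu> N \<le> emeasure ?\<nu> (\<Union>m. B m)"
      proof (rule emeasure_mono)
        show "N \<subseteq> (\<Union>m. B m)" using D(5) by (simp only: U)
        show "(\<Union>m. B m) \<in> sets ?\<nu>" by (rule sets.countable_UN) (use Bsets in blast)
      qed
      also have "\<dots> = (SUP m. emeasure ?\<nu> (B m))"
      proof (rule SUP_emeasure_incseq[symmetric])
        show "range B \<subseteq> sets ?\<nu>" using Bsets by blast
        show "incseq B" unfolding B_def by (intro monoI UN_mono) auto
      qed
      also have "\<dots> \<le> ennreal \<epsilon>"
      proof (rule SUP_least)
        fix m show "emeasure ?\<nu> (B m) \<le> ennreal \<epsilon>"
          using fin[of "?f ` {..<m}"] from_nat_into[OF False] by (auto simp: B_def)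
      qed
      finally show ?thesis .
    qed
  qed
  then have "emeasure ?\<nu> N \<le> 0" by - (rule ennreal_le_epsilon, simp)
  then show ?thesis by simp
qed

lemma interval_measure_abs_cont_density:
  assumes ac: "abs_cont_wrt id W" and mono: "mono W"
  obtains f where "f \<in> borel_measurable borel" "\<And>x. f x \<ge> 0"
    "interval_measure W = density lborel (\<lambda>x. ennreal (f x))"
proof -
  let ?\<nu> = "interval_measure W"
  have mono': "\<And>x y. x \<le> y \<Longrightarrow> W x \<le> W y" using mono by (simp add: mono_def)
  have "absolutely_continuous lborel ?\<nu>"
    unfolding absolutely_continuous_def
  proof (rule subsetI)
    fix N assume N: "N \<in> null_sets (lborel :: real measure)"
    \<comment> \<open>\<open>Suc n\<close> instead of n keeps the interval nondegenerate, as the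
      bounded version demands.\<close>
    have "emeasure ?\<nu> (N \<inter> {-(real (Suc n))..real (Suc n)}) = 0" for n
      by (rule interval_measure_abs_cont_null_bounded[OF ac mono null_set_Int2[OF N], of _ "-(real (Suc n))" "real (Suc n)"])
        auto
    then have "emeasure ?\<nu> (\<Union>n. N \<inter> {-(real (Suc n))..real (Suc n)}) = 0"
      by (rule emeasure_UN_eq_0) (use N in auto)
    moreover have "(\<Union>n. N \<inter> {-(real (Suc n))..real (Suc n)}) = N"
    proof -
      have "\<exists>n. x \<in> {-(real (Suc n))..real (Suc n)}" for x
      proof -
        obtain n where "\<bar>x\<bar> \<le> real n" using real_arch_simple by blast
        then show ?thesis by (intro exI[of _ n]) auto
      qed
      then show ?thesis by blast
    qed
    ultimately have "emeasure ?\<nu> N = 0" by (simp only:)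
    then show "N \<in> null_sets ?\<nu>" using N by (auto intro!: null_setsI)
  qed
  from sigma_finite_measure.Radon_Nikodym[OF sigma_finite_lborel this]
  obtain g where g: "g \<in> borel_measurable lborel" "density lborel g = ?\<nu>" by auto
  interpret \<nu>: sigma_finite_measure ?\<nu>
    by (rule sigma_finite_interval_measure[OF mono' abs_cont_right_continuous[OF ac]])
  have "sigma_finite_measure (density lborel g)" using g(2) \<nu>.sigma_finite_measure_axioms by simp
  \<comment> \<open>Sigma-finiteness of the interval measure excludes the value infinity almost
    everywhere, so the density can be replaced by a real function.\<close>
  then have fin: "AE x in lborel. g x \<noteq> \<infinity>"
    using sigma_finite_measure.sigma_finite_iff_density_finite[OF sigma_finite_lborel g(1)] g by simp
  show ?thesis
  proof (rule that[of "\<lambda>x. enn2real (g x)"])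
    show "?\<nu> = density lborel (\<lambda>x. ennreal (enn2real (g x)))"
      unfolding g(2)[symmetric]
      by (rule density_cong) (use g fin in \<open>auto simp: less_top[symmetric]\<close>)
  qed (use g in auto)
qed

text \<open>The differentiation theorem invoked here controls averages over [x, x + h] with h > 0.
  Left averages of f at x are right averages of the reflected function at -x, so the exceptional set
  is N together with the mirror image of N'.\<close>

lemma AE_has_derivative_indefinite_integral:
  fixes f F :: "real \<Rightarrow> real"
  assumes int: "\<And>a b. f integrable_on {a..b}"
    and F: "\<And>a b. a \<le> b \<Longrightarrow> F b - F a = integral {a..b} f"
  shows "AE x in lebesgue. (F has_real_derivative f x) (at x)"
proof -
  have "\<And>a b. f integrable_on cbox a b" using int by simp
  from integrable_ccontinuous_explicit[OF this] obtain N where N: "negligible N"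
    "\<And>x e. \<lbrakk>x \<notin> N; 0 < e\<rbrakk> \<Longrightarrow> \<exists>d>0. \<forall>h. 0 < h \<and> h < d \<longrightarrow>
        norm (integral (cbox x (x + h *\<^sub>R One)) f /\<^sub>R h ^ DIM(real) - f x) < e" by metis
  have "(\<lambda>x. f (- x)) integrable_on cbox a b" for a b
    using int[of "-b" "-a"] Henstock_Kurzweil_Integration.integrable_reflect_real[where f=f and a="-b" and b="-a"] by simp
  from integrable_ccontinuous_explicit[OF this] obtain N' where N': "negligible N'"
    "\<And>x e. \<lbrakk>x \<notin> N'; 0 < e\<rbrakk> \<Longrightarrow> \<exists>d>0. \<forall>h. 0 < h \<and> h < d \<longrightarrow>
        norm (integral (cbox x (x + h *\<^sub>R One)) (\<lambda>x. f (- x)) /\<^sub>R h ^ DIM(real) - f (- x)) < e" by metis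
  have neg: "negligible (N \<union> uminus ` N')"
    using N(1) N'(1)
    by (intro negligible_Un negligible_differentiable_image_negligible) (auto intro!: derivative_intros)
  have "(F has_real_derivative f x) (at x)" if x: "x \<notin> N \<union> uminus ` N'" for x
    unfolding DERIV_def
  proof (rule LIM_I)
    fix e :: real assume "e > 0"
    have x': "x \<notin> N" "- x \<notin> N'" using x by force+
    obtain d where d: "d > 0" "\<And>h. 0 < h \<Longrightarrow> h < d \<Longrightarrow> \<bar>integral {x..x + h} f / h - f x\<bar> < e"
      using N(2)[OF x'(1) \<open>e > 0\<close>] by (auto simp: divide_inverse_commute)
    obtain d' where d': "d' > 0" "\<And>h. 0 < h \<Longrightarrow> h < d' \<Longrightarrow>
        \<bar>integral {-x..-x + h} (\<lambda>x. f (- x)) / h - f x\<bar> < e"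
      using N'(2)[OF x'(2) \<open>e > 0\<close>] by (auto simp: divide_inverse_commute)
    have "\<bar>(F (x + h) - F x) / h - f x\<bar> < e" if h: "h \<noteq> 0" "\<bar>h\<bar> < min d d'" for h
    proof (cases "h > 0")
      case True
      then show ?thesis using d(2)[of h] h F[of x "x + h"] by simp
    next
      case False
      with h have "h < 0" by simp
      have "integral {-x..-x + (- h)} (\<lambda>x. f (- x)) = integral {x + h..x} f"
        using Henstock_Kurzweil_Integration.integral_reflect_real[where f=f and a="x + h" and b=x] by (simp add: algebra_simps)
      also have "\<dots> = F x - F (x + h)" using F[of "x + h" x] \<open>h < 0\<close> by simp
      finally have I: "integral {-x..-x + (- h)} (\<lambda>x. f (- x)) = F x - F (x + h)" .
      have "(F (x + h) - F x) / h = integral {-x..-x + (- h)} (\<lambda>x. f (- x)) / (- h)"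
        unfolding I using h(1) by (simp add: field_simps)
      then show ?thesis using d'(2)[of "- h"] h \<open>h < 0\<close> by simp
    qed
    then show "\<exists>s>0. \<forall>h. h \<noteq> 0 \<and> norm (h - 0) < s \<longrightarrow> norm ((F (x + h) - F x) / h - f x) < e"
      using d(1) d'(1) by (intro exI[of _ "min d d'"]) auto
  qed
  then show ?thesis
    by (intro AE_I'[of "N \<union> uminus ` N'"]) (use neg in \<open>auto simp: negligible_iff_null_sets\<close>)
qed

lemma AE_has_derivative_set_integral:
  fixes f F :: "real \<Rightarrow> real"
  assumes int: "\<And>a b. set_integrable lborel {a..b} f"
    and F: "\<And>a b. a \<le> b \<Longrightarrow> F b - F a = (LINT x:{a..b}|lborel. f x)"
  shows "AE x in lebesgue. (F has_real_derivative f x) (at x)"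
  using set_borel_integral_eq_integral[OF int] F by (intro AE_has_derivative_indefinite_integral) auto

lemma mono_abs_cont_density:
  assumes ac: "abs_cont_wrt id W" and mono: "mono W"
  obtains f where "f \<in> borel_measurable borel" "\<And>x. f x \<ge> 0"
    "interval_measure W = density lborel (\<lambda>x. ennreal (f x))"
    "AE x in lebesgue. (W has_real_derivative f x) (at x)"
proof -
  obtain f where f[measurable]: "f \<in> borel_measurable borel" and f0: "\<And>x. f x \<ge> 0"
    and d: "interval_measure W = density lborel (\<lambda>x. ennreal (f x))"
    using interval_measure_abs_cont_density[OF ac mono] by blast
  have hb: "has_bochner_integral lborel (\<lambda>x. indicator {a..b} x * f x) (W b - W a)" if "a \<le> b" for a b
  proof (rule has_bochner_integral_nn_integral)
    have "ennreal (W b - W a) = emeasure (interval_measure W) {a..b}"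
      using emeasure_interval_measure_Icc[OF that _ abs_cont_continuous[OF ac]] mono by (simp add: mono_def)
    also have "\<dots> = (\<integral>\<^sup>+x. ennreal (f x) * indicator {a..b} x \<partial>lborel)"
      unfolding d by (rule emeasure_density) auto
    also have "\<dots> = (\<integral>\<^sup>+x. ennreal (indicator {a..b} x * f x) \<partial>lborel)"
      by (intro nn_integral_cong) (auto split: split_indicator)
    finally show "(\<integral>\<^sup>+x. ennreal (indicator {a..b} x * f x) \<partial>lborel) = ennreal (W b - W a)" by simp
  qed (use f0 mono that in \<open>auto simp: mono_def\<close>)
  have "AE x in lebesgue. (W has_real_derivative f x) (at x)"
  proof (rule AE_has_derivative_set_integral)
    fix a b :: real
    show "set_integrable lborel {a..b} f"
    proof (cases "a \<le> b")
      case True then show ?thesis using hb[OF True] by (simp add: set_integrable_def has_bochner_integral_iff)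
    qed (simp add: set_integrable_def)
    show "W b - W a = (LINT x:{a..b}|lborel. f x)" if "a \<le> b"
      using hb[OF that] by (simp add: set_lebesgue_integral_def has_bochner_integral_iff)
  qed
  with f f0 d show ?thesis by (rule that)
qed

text \<open>The factor 2 suits V - u, whose increments are bounded by those of V plus those of u,
  hence by twice those of V.\<close>

lemma abs_cont_wrt_dominated:
  assumes "abs_cont_wrt w V" "\<And>x y. x \<le> y \<Longrightarrow> \<bar>z y - z x\<bar> \<le> 2 * \<bar>V y - V x\<bar>"
  shows "abs_cont_wrt w z"
  unfolding abs_cont_wrt_alt
proof (intro allI impI)
  fix a b \<epsilon> :: real assume "\<epsilon> > 0"
  then obtain \<delta> where \<delta>: "\<delta> > 0" "\<And>n x y. nonoverlapping a b n x y \<Longrightarrow> (\<Sum>i<n. w (y i) - w (x i)) < \<delta> \<Longrightarrow>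
       (\<Sum>i<n. \<bar>V (y i) - V (x i)\<bar>) < \<epsilon> / 2"
    using abs_cont_wrtD[OF assms(1), of "\<epsilon> / 2" a b] by auto
  have "(\<Sum>i<n. \<bar>z (y i) - z (x i)\<bar>) < \<epsilon>"
    if *: "nonoverlapping a b n x y" "(\<Sum>i<n. w (y i) - w (x i)) < \<delta>" for n x y
  proof -
    have "(\<Sum>i<n. \<bar>z (y i) - z (x i)\<bar>) \<le> (\<Sum>i<n. 2 * \<bar>V (y i) - V (x i)\<bar>)"
      by (rule sum_mono) (use *(1) assms(2) in \<open>auto simp: nonoverlapping_def\<close>)
    then show ?thesis using \<delta>(2)[OF *] by (simp add: sum_distrib_left[symmetric])
  qed
  with \<delta>(1) show "\<exists>\<delta>>0. \<forall>n x y. nonoverlapping a b n x y \<longrightarrow> (\<Sum>i<n. w (y i) - w (x i)) < \<delta> \<longrightarrow>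
      (\<Sum>i<n. \<bar>z (y i) - z (x i)\<bar>) < \<epsilon>" by blast
qed

lemma abs_cont_wrt_diff:
  assumes "abs_cont_wrt w u" "abs_cont_wrt w v"
  shows "abs_cont_wrt w (\<lambda>x. u x - v x)"
  unfolding abs_cont_wrt_alt
proof (intro allI impI)
  fix a b \<epsilon> :: real assume "\<epsilon> > 0"
  then have e: "\<epsilon> / 2 > 0" by simp
  obtain \<delta> where \<delta>: "\<delta> > 0" "\<And>n x y. nonoverlapping a b n x y \<Longrightarrow> (\<Sum>i<n. w (y i) - w (x i)) < \<delta> \<Longrightarrow>
       (\<Sum>i<n. \<bar>u (y i) - u (x i)\<bar>) < \<epsilon> / 2"
    using abs_cont_wrtD[OF assms(1) e, of a b] by blast
  obtain \<delta>' where \<delta>': "\<delta>' > 0" "\<And>n x y. nonoverlapping a b n x y \<Longrightarrow> (\<Sum>i<n. w (y i) - w (x i)) < \<delta>' \<Longrightarrow>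
       (\<Sum>i<n. \<bar>v (y i) - v (x i)\<bar>) < \<epsilon> / 2"
    using abs_cont_wrtD[OF assms(2) e, of a b] by blast
  have "(\<Sum>i<n. \<bar>(u (y i) - v (y i)) - (u (x i) - v (x i))\<bar>) < \<epsilon>"
    if *: "nonoverlapping a b n x y" "(\<Sum>i<n. w (y i) - w (x i)) < min \<delta> \<delta>'" for n x y
  proof -
    have "(\<Sum>i<n. \<bar>(u (y i) - v (y i)) - (u (x i) - v (x i))\<bar>) \<le> (\<Sum>i<n. \<bar>u (y i) - u (x i)\<bar> + \<bar>v (y i) - v (x i)\<bar>)"
      by (rule sum_mono) linarith
    then show ?thesis using \<delta>(2)[OF *(1)] \<delta>'(2)[OF *(1)] *(2) by (simp add: sum.distrib)
  qed
  then show "\<exists>\<delta>>0. \<forall>n x y. nonoverlapping a b n x y \<longrightarrow> (\<Sum>i<n. w (y i) - w (x i)) < \<delta> \<longrightarrow>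
     (\<Sum>i<n. \<bar>(u (y i) - v (y i)) - (u (x i) - v (x i))\<bar>) < \<epsilon>"
    using \<delta>(1) \<delta>'(1) by (intro exI[of _ "min \<delta> \<delta>'"]) simp
qed

theorem abs_cont_AE_differentiable:
  assumes ac: "abs_cont_wrt id u"
  shows "AE x in lebesgue. u differentiable (at x)"
proof -
  \<comment> \<open>The variation needs a starting point, so differentiability is obtained to the
    right of a only; countably many starting points -n then exhaust the line.\<close>
  have "AE x in lebesgue. a < x \<longrightarrow> u differentiable (at x)" for a
  proof -
    define V where "V x = total_variation u a (max a x)" for x
    have V: "abs_cont_wrt id V" unfolding V_def by (rule abs_cont_total_variation[OF ac])
    have le: "\<bar>u (max a y) - u (max a x)\<bar> \<le> V y - V x" if "x \<le> y" for x y
    proof -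
      have "a \<le> max a x" "max a x \<le> max a y" using that by auto
      from total_variation_superadd[OF ac this] show ?thesis by (simp add: V_def)
    qed
    have mV: "mono V" using le by (intro monoI) (meson abs_ge_zero diff_ge_0_iff_ge order_trans)
    define Z where "Z x = V x - u (max a x)" for x
    have mZ: "mono Z" using le by (intro monoI) (smt (verit) Z_def)
    have Z: "abs_cont_wrt id Z"
      using V by (rule abs_cont_wrt_dominated) (smt (verit) Z_def le)
    obtain f where f: "AE x in lebesgue. (V has_real_derivative f x) (at x)"
      using mono_abs_cont_density[OF V mV] by blast
    obtain g where g: "AE x in lebesgue. (Z has_real_derivative g x) (at x)"
      using mono_abs_cont_density[OF Z mZ] by blast
    from f g show ?thesis
    proof eventually_elim
      case (elim x)
      have 1: "((\<lambda>x. V x - Z x) has_real_derivative (f x - g x)) (at x)"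
        using elim by (intro derivative_intros)
      show ?case
      proof
        assume "a < x"
        \<comment> \<open>V - Z is u composed with the clamp at a, which agrees with u on the open
          half-line beyond a.\<close>
        have "(u has_real_derivative (f x - g x)) (at x)"
          by (rule has_field_derivative_transform_within_open[OF 1, of "{a<..}"])
            (use \<open>a < x\<close> in \<open>auto simp: Z_def\<close>)
        then show "u differentiable (at x)"
          by (auto simp: real_differentiable_def)
      qed
    qed
  qed
  then have "AE x in lebesgue. \<forall>n::nat. - real n < x \<longrightarrow> u differentiable (at x)"
    by (subst AE_all_countable) blast
  then show ?thesis
  proof eventually_elim
    case (elim x)
    obtain n where "- x < real n" using reals_Archimedean2 by blast
    then show ?case using elim by (metis minus_less_iff)
  qed
qed

section \<open>Time changes by a scale function with unit density\<close>

locale unit_scale =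
  fixes s :: "real \<Rightarrow> real" and G :: "real set"
  assumes s_mono: "strict_mono s"
    and s_ac: "abs_cont_wrt id s"
    and s_deriv: "AE x in lebesgue. (s has_real_derivative indicator G x) (at x)"
    and G_open: "open G"
begin

section \<open>The measure ds as Lebesgue measure restricted to G\<close>

lemma G_borel[measurable]: "G \<in> sets borel"
  using G_open by simp

lemma s_le: "x \<le> y \<Longrightarrow> s x \<le> s y"
  using s_mono by (simp add: strict_mono_less_eq)

text \<open>The density f of ds is almost everywhere the derivative of s, hence by uniqueness of
  derivatives it is the indicator of G. Every ds-integral thereby becomes a Lebesgue integral over
  G.\<close>

lemma ds_density: "interval_measure s = density lborel (\<lambda>x. ennreal (indicator G x))"
proof -
  have "mono s" using s_le by (rule monoI)
  from mono_abs_cont_density[OF s_ac this] obtain f where f[measurable]: "f \<in> borel_measurable borel"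
    and d: "interval_measure s = density lborel (\<lambda>x. ennreal (f x))"
    and f': "AE x in lebesgue. (s has_real_derivative f x) (at x)" by blast
  from f' s_deriv have "AE x in lebesgue. f x = indicator G x"
    by eventually_elim (rule DERIV_unique)
  then have "AE x in lborel. f x = indicator G x" by (simp add: AE_completion_iff)
  then show ?thesis unfolding d by (intro density_cong) auto
qed

lemma emeasure_G_Ioc:
  assumes "a \<le> b"
  shows "emeasure lborel (G \<inter> {a<..b}) = ennreal (s b - s a)"
proof -
  have "ennreal (s b - s a) = emeasure (interval_measure s) {a<..b}"
    using emeasure_interval_measure_Ioc[OF assms s_le abs_cont_right_continuous[OF s_ac]] by simp
  also have "\<dots> = (\<integral>\<^sup>+x. ennreal (indicator G x) * indicator {a<..b} x \<partial>lborel)"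
    unfolding ds_density by (rule emeasure_density) auto
  also have "\<dots> = (\<integral>\<^sup>+x. indicator (G \<inter> {a<..b}) x \<partial>lborel)"
    by (intro nn_integral_cong) (auto split: split_indicator)
  finally show ?thesis by simp
qed

text \<open>The increment of s is the measure of the part of G in the interval. This is what later
  turns absolute continuity with respect to s into ordinary absolute continuity.\<close>

lemma s_lipschitz:
  assumes "a \<le> b"
  shows "s b - s a \<le> b - a"
proof -
  have "ennreal (s b - s a) \<le> emeasure lborel {a<..b}"
    unfolding emeasure_G_Ioc[OF assms, symmetric] by (rule emeasure_mono) auto
  then show ?thesis using assms by simp
qed

lemma ds_integrable_iff:
  fixes g :: "real \<Rightarrow> real"
  assumes "g \<in> borel_measurable borel"
  shows "integrable (interval_measure s) g \<longleftrightarrow> integrable lborel (\<lambda>x. indicator G x * g x)"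
  unfolding ds_density using assms by (subst integrable_density) auto

lemma ds_integral:
  fixes g :: "real \<Rightarrow> real"
  assumes "g \<in> borel_measurable borel"
  shows "integral\<^sup>L (interval_measure s) g = (LINT x|lborel. indicator G x * g x)"
  unfolding ds_density using assms by (subst integral_density) auto

lemma L2_integrable_on:
  fixes g :: "real \<Rightarrow> real"
  assumes [measurable]: "g \<in> borel_measurable borel" "A \<in> sets borel"
    and g2: "integrable lborel (\<lambda>x. indicator G x * (g x)\<^sup>2)" and A: "emeasure lborel (G \<inter> A) < \<infinity>"
  shows "integrable lborel (\<lambda>x. indicator A x * (indicator G x * g x))"
proof (rule Bochner_Integration.integrable_bound)
  have "integrable lborel (\<lambda>x. indicator (G \<inter> A) x :: real)"
    using A by (intro integrable_real_indicator) auto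
  then show "integrable lborel (\<lambda>x. indicator (G \<inter> A) x + indicator G x * (g x)\<^sup>2)"
    using g2 by simp
  \<comment> \<open>A pointwise substitute for Cauchy-Schwarz: 1 is integrable over the part of G in
    A, and the square is integrable by assumption.\<close>
  have "\<bar>t\<bar> \<le> 1 + t\<^sup>2" for t :: real
  proof -
    have "0 \<le> (\<bar>t\<bar> - 1)\<^sup>2" "0 \<le> t\<^sup>2" "0 \<le> \<bar>t\<bar>" by auto
    then show ?thesis unfolding power2_diff by simp
  qed
  then show "AE x in lborel. norm (indicator A x * (indicator G x * g x)) \<le> norm (indicator (G \<inter> A) x + indicator G x * (g x)\<^sup>2)"
    by (intro AE_I2) (auto split: split_indicator)
qed auto

lemma emeasure_G_bounded: "emeasure lborel (G \<inter> {a<..b}) < \<infinity>" "emeasure lborel (G \<inter> {a..b}) < \<infinity>"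
proof -
  have "emeasure lborel (G \<inter> {a..b}) \<le> emeasure lborel {a..b}" by (rule emeasure_mono) auto
  also have "\<dots> < \<infinity>" by (simp add: emeasure_lborel_Icc_eq)
  finally show 1: "emeasure lborel (G \<inter> {a..b}) < \<infinity>" .
  have "emeasure lborel (G \<inter> {a<..b}) \<le> emeasure lborel (G \<inter> {a..b})" by (rule emeasure_mono) auto
  with 1 show "emeasure lborel (G \<inter> {a<..b}) < \<infinity>" by simp
qed

lemma AE_derivative_of_density:
  fixes g v :: "real \<Rightarrow> real"
  assumes [measurable]: "g \<in> borel_measurable borel"
    and g2: "integrable lborel (\<lambda>x. indicator G x * (g x)\<^sup>2)"
    and v: "\<And>a b. a \<le> b \<Longrightarrow> v b - v a = (LINT x|lborel. indicator {a<..b} x * (indicator G x * g x))"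
  shows "AE x in lebesgue. (v has_real_derivative indicator G x * g x) (at x)"
proof (rule AE_has_derivative_set_integral)
  fix a b :: real
  show "set_integrable lborel {a..b} (\<lambda>x. indicator G x * g x)"
    using L2_integrable_on[OF assms(1) _ g2 emeasure_G_bounded(2)[of a b]] by (simp add: set_integrable_def)
  assume "a \<le> b"
  have "AE x in lborel. indicator {a<..b} x = (indicator {a..b} x :: real)"
    using AE_lborel_singleton[of a] by eventually_elim (auto split: split_indicator)
  then have "(LINT x|lborel. indicator {a<..b} x * (indicator G x * g x)) = (LINT x|lborel. indicator {a..b} x * (indicator G x * g x))"
    by (intro integral_cong_AE) auto
  then show "v b - v a = (LINT x:{a..b}|lborel. indicator G x * g x)"
    using v[OF \<open>a \<le> b\<close>] by (simp add: set_lebesgue_integral_def)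
qed

section \<open>Membership in \<open>Fse s\<close> expressed by a density on G\<close>

lemma FseD:
  assumes "v \<in> Fse s"
  obtains g where "g \<in> borel_measurable borel" "integrable lborel (\<lambda>x. indicator G x * (g x)\<^sup>2)"
    "\<And>a b. a \<le> b \<Longrightarrow> v b - v a = (LINT x|lborel. indicator {a<..b} x * (indicator G x * g x))"
    "AE x in lebesgue. (v has_real_derivative indicator G x * g x) (at x)"
    "\<not> filterlim s at_top at_top \<Longrightarrow> (v \<longlongrightarrow> 0) at_top"
    "\<not> filterlim s at_bot at_bot \<Longrightarrow> (v \<longlongrightarrow> 0) at_bot"
proof -
  from assms obtain g where g: "is_ds_density s v g" "integrable (interval_measure s) (\<lambda>x. (g x)\<^sup>2)"
    and l: "\<not> filterlim s at_top at_top \<longrightarrow> (v \<longlongrightarrow> 0) at_top" "\<not> filterlim s at_bot at_bot \<longrightarrow> (v \<longlongrightarrow> 0) at_bot"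
    unfolding Fse_def by blast
  have m[measurable]: "g \<in> borel_measurable borel" using g(1) by (simp add: is_ds_density_def)
  have g2: "integrable lborel (\<lambda>x. indicator G x * (g x)\<^sup>2)"
    using g(2) by (simp add: ds_integrable_iff)
  have v: "v b - v a = (LINT x|lborel. indicator {a<..b} x * (indicator G x * g x))" if "a \<le> b" for a b
    using g(1) that by (simp add: is_ds_density_def set_lebesgue_integral_def ds_integral mult.left_commute)
  from m g2 v AE_derivative_of_density[OF m g2 v] l show ?thesis by (intro that) auto
qed

text \<open>By |t| \<le> \<open>\<eta> * t^2 + 1 / (4 * \<eta>)\<close> an increment of v is bounded
  by \<open>\<eta>\<close> times the increment of the cumulated energy H plus a multiple of the
  increment of s. The H-part sums to at most \<open>\<eta> * C\<close> for every family; the s-part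
  is made small by \<open>\<delta>\<close>.\<close>

lemma abs_cont_wrt_of_density:
  fixes g v :: "real \<Rightarrow> real"
  assumes [measurable]: "g \<in> borel_measurable borel"
    and g2: "integrable lborel (\<lambda>x. indicator G x * (g x)\<^sup>2)"
    and v: "\<And>a b. a \<le> b \<Longrightarrow> v b - v a = (LINT x|lborel. indicator {a<..b} x * (indicator G x * g x))"
  shows "abs_cont_wrt s v"
  unfolding abs_cont_wrt_alt
proof (intro allI impI)
  fix a b \<epsilon> :: real assume \<epsilon>: "\<epsilon> > 0"
  define H where "H x = (LINT t|lborel. indicator {..x} t * (indicator G t * (g t)\<^sup>2))" for x
  define C where "C = (LINT t|lborel. indicator G t * (g t)\<^sup>2)"
  have Hint: "integrable lborel (\<lambda>t. indicator A t * (indicator G t * (g t)\<^sup>2))" if "A \<in> sets borel" for A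
    using g2 that by (intro Bochner_Integration.integrable_bound[OF g2]) (auto split: split_indicator)
  have H0: "0 \<le> H x" for x unfolding H_def by (intro integral_nonneg_AE) auto
  have HC: "H x \<le> C" for x unfolding H_def C_def
    by (intro integral_mono Hint g2) (auto split: split_indicator)
  have Hmono: "mono H" unfolding H_def
    by (intro monoI integral_mono Hint) (auto split: split_indicator)
  have "C \<ge> 0" using H0[of 0] HC[of 0] by simp
  \<comment> \<open>Makes \<open>\<eta> * C\<close> smaller than \<open>\<epsilon> / 2\<close>; the
    summand 1 avoids dividing by 0. The matching \<open>\<delta>\<close> is
    \<open>2 * \<eta> * \<epsilon>\<close>, which puts the s-part below
    \<open>\<epsilon> / 2\<close> as well.\<close>
  define \<eta> where "\<eta> = \<epsilon> / (2 * (C + 1))"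
  have \<eta>: "\<eta> > 0" using \<epsilon> \<open>C \<ge> 0\<close> by (simp add: \<eta>_def)
  have "\<eta> * C < \<epsilon> / 2" using \<epsilon> \<open>C \<ge> 0\<close> by (simp add: \<eta>_def field_simps)
  have incr: "\<bar>v q - v p\<bar> \<le> \<eta> * (H q - H p) + (s q - s p) / (4 * \<eta>)" if pq: "p \<le> q" for p q
  proof -
    let ?I = "indicator {p<..q} :: real \<Rightarrow> real"
    have i1: "integrable lborel (\<lambda>x. ?I x * (indicator G x * g x))"
      using L2_integrable_on[OF assms(1) _ g2 emeasure_G_bounded(1)] by simp
    have i2: "integrable lborel (\<lambda>x. ?I x * (indicator G x * (g x)\<^sup>2))" by (rule Hint) simp
    have hb: "has_bochner_integral lborel (indicator (G \<inter> {p<..q}) :: real \<Rightarrow> real) (s q - s p)"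
      using has_bochner_integral_real_indicator[of "G \<inter> {p<..q}" lborel] emeasure_G_bounded(1)[of p q]
        emeasure_G_Ioc[OF pq] s_le[OF pq] by (simp add: measure_def)
    have pt: "\<bar>t\<bar> \<le> \<eta> * t\<^sup>2 + 1 / (4 * \<eta>)" for t
    proof -
      have "0 \<le> (2 * \<eta> * \<bar>t\<bar> - 1)\<^sup>2" by simp
      then have "4 * \<eta> * \<bar>t\<bar> \<le> 4 * \<eta> * (\<eta> * t\<^sup>2) + 1" by (simp add: power2_eq_square algebra_simps)
      then show ?thesis using \<eta> by (simp add: field_simps)
    qed
    have "\<bar>v q - v p\<bar> \<le> (LINT x|lborel. \<bar>?I x * (indicator G x * g x)\<bar>)"
      unfolding v[OF pq] by (rule integral_abs_bound)
    also have "\<dots> \<le> (LINT x|lborel. \<eta> * (?I x * (indicator G x * (g x)\<^sup>2)) + (1 / (4 * \<eta>)) * indicator (G \<inter> {p<..q}) x)"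
    proof (rule integral_mono)
      show "integrable lborel (\<lambda>x. \<bar>?I x * (indicator G x * g x)\<bar>)" using i1 by simp
      show "integrable lborel (\<lambda>x. \<eta> * (?I x * (indicator G x * (g x)\<^sup>2)) + (1 / (4 * \<eta>)) * indicator (G \<inter> {p<..q}) x)"
        using i2 hb by (intro Bochner_Integration.integrable_add integrable_mult_right) (auto simp: has_bochner_integral_iff)
      show "\<bar>?I x * (indicator G x * g x)\<bar> \<le> \<eta> * (?I x * (indicator G x * (g x)\<^sup>2)) + (1 / (4 * \<eta>)) * indicator (G \<inter> {p<..q}) x" for x
        using pt[of "g x"] by (auto split: split_indicator)
    qed
    also have "\<dots> = \<eta> * (LINT x|lborel. ?I x * (indicator G x * (g x)\<^sup>2)) + (s q - s p) / (4 * \<eta>)"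
      using i2 hb by (subst Bochner_Integration.integral_add) (auto simp: has_bochner_integral_iff)
    also have "(LINT x|lborel. ?I x * (indicator G x * (g x)\<^sup>2)) = H q - H p"
      unfolding H_def using pq
      by (subst Bochner_Integration.integral_diff[symmetric])
        (auto intro!: Hint Bochner_Integration.integral_cong split: split_indicator)
    finally show ?thesis .
  qed
  have "(\<Sum>i<n. \<bar>v (y i) - v (x i)\<bar>) < \<epsilon>"
    if fam: "nonoverlapping a b n x y" "(\<Sum>i<n. s (y i) - s (x i)) < 2 * \<eta> * \<epsilon>" for n x y
  proof (cases "n = 0")
    case False
    have "a \<le> x 0" "x 0 \<le> y 0" "y 0 \<le> b" using fam(1) False by (auto simp: nonoverlapping_def)
    then have "a \<le> b" by linarith
    then have "(\<Sum>i<n. H (y i) - H (x i)) \<le> C"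
      using nonoverlapping_sum_le[OF fam(1) _ Hmono] HC[of b] H0[of a] by fastforce
    then have 1: "\<eta> * (\<Sum>i<n. H (y i) - H (x i)) \<le> \<eta> * C" using \<eta> by simp
    have 2: "(\<Sum>i<n. s (y i) - s (x i)) / (4 * \<eta>) < \<epsilon> / 2" using fam(2) \<eta> by (simp add: field_simps)
    have "(\<Sum>i<n. \<bar>v (y i) - v (x i)\<bar>) \<le> (\<Sum>i<n. \<eta> * (H (y i) - H (x i)) + (s (y i) - s (x i)) / (4 * \<eta>))"
      by (intro sum_mono incr) (use fam(1) in \<open>auto simp: nonoverlapping_def\<close>)
    also have "\<dots> = \<eta> * (\<Sum>i<n. H (y i) - H (x i)) + (\<Sum>i<n. s (y i) - s (x i)) / (4 * \<eta>)"
      by (simp add: sum.distrib sum_distrib_left sum_divide_distrib)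
    finally show ?thesis using 1 2 \<open>\<eta> * C < \<epsilon> / 2\<close> by linarith
  qed (use \<epsilon> in simp)
  then show "\<exists>\<delta>>0. \<forall>n x y. nonoverlapping a b n x y \<longrightarrow> (\<Sum>i<n. s (y i) - s (x i)) < \<delta> \<longrightarrow> (\<Sum>i<n. \<bar>v (y i) - v (x i)\<bar>) < \<epsilon>"
    using \<eta> \<epsilon> by (intro exI[of _ "2 * \<eta> * \<epsilon>"]) simp
qed

lemma FseI:
  assumes m[measurable]: "g \<in> borel_measurable borel"
    and g2: "integrable lborel (\<lambda>x. indicator G x * (g x)\<^sup>2)"
    and v: "\<And>a b. a \<le> b \<Longrightarrow> v b - v a = (LINT x|lborel. indicator {a<..b} x * (indicator G x * g x))"
    and "\<not> filterlim s at_top at_top \<Longrightarrow> (v \<longlongrightarrow> 0) at_top"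
    and "\<not> filterlim s at_bot at_bot \<Longrightarrow> (v \<longlongrightarrow> 0) at_bot"
  shows "v \<in> Fse s"
proof -
  have "is_ds_density s v g"
    unfolding is_ds_density_def
  proof (intro conjI allI impI m)
    fix a b :: real assume ab: "a \<le> b"
    show "set_integrable (interval_measure s) {a<..b} g"
      using L2_integrable_on[OF m _ g2 emeasure_G_bounded(1)]
      by (simp add: set_integrable_def ds_integrable_iff mult.left_commute)
    show "v b - v a = (LINT x:{a<..b}|interval_measure s. g x)"
      using v[OF ab] by (simp add: set_lebesgue_integral_def ds_integral mult.left_commute)
  qed
  moreover have "integrable (interval_measure s) (\<lambda>x. (g x)\<^sup>2)"
    using g2 by (simp add: ds_integrable_iff)
  ultimately show ?thesis
    using abs_cont_wrt_of_density[OF m g2 v] assms(4,5) unfolding Fse_def by blast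
qed

section \<open>Behaviour of s at the two ends and the measure of G\<close>

lemma emeasure_G_right: "emeasure lborel (G \<inter> {a<..}) = \<infinity> \<longleftrightarrow> filterlim s at_top at_top"
proof -
  have U: "(\<Union>n::nat. G \<inter> {a<..a + real n}) = G \<inter> {a<..}"
  proof safe
    fix x assume "x \<in> G" "x > a"
    obtain n where "x - a \<le> real n" using real_arch_simple by blast
    then show "x \<in> (\<Union>n::nat. G \<inter> {a<..a + real n})" using \<open>x \<in> G\<close> \<open>x > a\<close> by (auto intro!: exI[of _ n])
  qed auto
  have "(SUP n::nat. emeasure lborel (G \<inter> {a<..a + real n})) = emeasure lborel (\<Union>n::nat. G \<inter> {a<..a + real n})"
    by (rule SUP_emeasure_incseq) (auto simp: incseq_def)
  \<comment> \<open>The measure of G beyond a is the total increase of s beyond a, read along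
    integer steps; monotonicity of s extends this to the limit over the reals.\<close>
  then have E: "emeasure lborel (G \<inter> {a<..}) = (SUP n::nat. ennreal (s (a + real n) - s a))"
    unfolding U by (simp add: emeasure_G_Ioc)
  show ?thesis
  proof
    assume inf: "emeasure lborel (G \<inter> {a<..}) = \<infinity>"
    show "filterlim s at_top at_top"
      unfolding filterlim_at_top
    proof
      fix Z
      have "\<exists>n::nat. Z \<le> s (a + real n)"
      proof (rule ccontr)
        assume "\<not> ?thesis"
        then have "(SUP n::nat. ennreal (s (a + real n) - s a)) \<le> ennreal (Z - s a)"
          by (intro SUP_least ennreal_leI) (simp add: not_le less_imp_le)
        then have "emeasure lborel (G \<inter> {a<..}) \<le> ennreal (Z - s a)" unfolding E .
        then show False using inf by (simp add: top_unique)
      qed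
      then obtain n :: nat where n: "Z \<le> s (a + real n)" ..
      show "eventually (\<lambda>x. Z \<le> s x) at_top"
        using eventually_ge_at_top[of "a + real n"] by eventually_elim (meson n s_le order_trans)
    qed
  next
    assume lim: "filterlim s at_top at_top"
    have "ennreal r \<le> emeasure lborel (G \<inter> {a<..})" for r
    proof -
      have "eventually (\<lambda>x. r + s a \<le> s x) at_top" using lim by (simp add: filterlim_at_top)
      then obtain x where "r + s a \<le> s x" "a \<le> x"
        using eventually_conj[OF _ eventually_ge_at_top[of a]] by (metis (no_types, lifting) eventually_happens' trivial_limit_at_top_linorder)
      then have "ennreal r \<le> ennreal (s x - s a)" by (intro ennreal_leI) simp
      also have "\<dots> \<le> emeasure lborel (G \<inter> {a<..})"
        unfolding emeasure_G_Ioc[OF \<open>a \<le> x\<close>, symmetric] by (rule emeasure_mono) auto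
      finally show ?thesis .
    qed
    then have "emeasure lborel (G \<inter> {a<..}) = top"
    proof (cases "emeasure lborel (G \<inter> {a<..})")
      case (real r)
      then show ?thesis using \<open>\<And>r. ennreal r \<le> _\<close>[of "r + 1"] by simp
    qed
    then show "emeasure lborel (G \<inter> {a<..}) = \<infinity>" by simp
  qed
qed

lemma emeasure_G_left: "emeasure lborel (G \<inter> {..a}) = \<infinity> \<longleftrightarrow> filterlim s at_bot at_bot"
proof -
  have U: "(\<Union>n::nat. G \<inter> {a - real n<..a}) = G \<inter> {..a}"
  proof safe
    fix x assume "x \<in> G" "x \<le> a"
    obtain n where "a - x < real n" using reals_Archimedean2 by blast
    then show "x \<in> (\<Union>n::nat. G \<inter> {a - real n<..a})" using \<open>x \<in> G\<close> \<open>x \<le> a\<close> by (auto intro!: exI[of _ n])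
  qed auto
  have "(SUP n::nat. emeasure lborel (G \<inter> {a - real n<..a})) = emeasure lborel (\<Union>n::nat. G \<inter> {a - real n<..a})"
    by (rule SUP_emeasure_incseq) (auto simp: incseq_def)
  then have E: "emeasure lborel (G \<inter> {..a}) = (SUP n::nat. ennreal (s a - s (a - real n)))"
    unfolding U by (simp add: emeasure_G_Ioc)
  show ?thesis
  proof
    assume inf: "emeasure lborel (G \<inter> {..a}) = \<infinity>"
    show "filterlim s at_bot at_bot"
      unfolding filterlim_at_bot
    proof
      fix Z
      have "\<exists>n::nat. s (a - real n) \<le> Z"
      proof (rule ccontr)
        assume "\<not> ?thesis"
        then have "(SUP n::nat. ennreal (s a - s (a - real n))) \<le> ennreal (s a - Z)"
          by (intro SUP_least ennreal_leI) (simp add: not_le less_imp_le)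
        then have "emeasure lborel (G \<inter> {..a}) \<le> ennreal (s a - Z)" unfolding E .
        then show False using inf by (simp add: top_unique)
      qed
      then obtain n :: nat where n: "s (a - real n) \<le> Z" ..
      show "eventually (\<lambda>x. s x \<le> Z) at_bot"
        using eventually_le_at_bot[of "a - real n"] by eventually_elim (meson n s_le order_trans)
    qed
  next
    assume lim: "filterlim s at_bot at_bot"
    have "ennreal r \<le> emeasure lborel (G \<inter> {..a})" for r
    proof -
      have "eventually (\<lambda>x. s x \<le> s a - r) at_bot" using lim by (simp add: filterlim_at_bot)
      then obtain x where "s x \<le> s a - r" "x \<le> a"
        using eventually_conj[OF _ eventually_le_at_bot[of a]] by (metis (no_types, lifting) eventually_happens' trivial_limit_at_bot_linorder)
      then have "ennreal r \<le> ennreal (s a - s x)" by (intro ennreal_leI) simp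
      also have "\<dots> \<le> emeasure lborel (G \<inter> {..a})"
        unfolding emeasure_G_Ioc[OF \<open>x \<le> a\<close>, symmetric] by (rule emeasure_mono) auto
      finally show ?thesis .
    qed
    then have "emeasure lborel (G \<inter> {..a}) = top"
    proof (cases "emeasure lborel (G \<inter> {..a})")
      case (real r)
      then show ?thesis using \<open>\<And>r. ennreal r \<le> _\<close>[of "r + 1"] by simp
    qed
    then show "emeasure lborel (G \<inter> {..a}) = \<infinity>" by simp
  qed
qed

lemma emeasure_G_infinite_iff:
  "emeasure lborel G = \<infinity> \<longleftrightarrow> filterlim s at_bot at_bot \<or> filterlim s at_top at_top"
proof -
  have "G = (G \<inter> {..0}) \<union> (G \<inter> {0<..})" by auto
  then have "emeasure lborel G = emeasure lborel (G \<inter> {..0}) + emeasure lborel (G \<inter> {0<..})"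
    using plus_emeasure[of "G \<inter> {..0}" lborel "G \<inter> {0<..}"] by fastforce
  then show ?thesis
    using emeasure_G_left[of 0] emeasure_G_right[of 0] by (simp add: ennreal_add_eq_top)
qed

text \<open>Permits dividing by the measure of G when the mean of a function over G is
  formed.\<close>

lemma emeasure_G_pos: "emeasure lborel G > 0"
proof -
  have "0 < ennreal (s 1 - s 0)" using s_mono by (simp add: strict_mono_def)
  also have "\<dots> \<le> emeasure lborel G"
    unfolding emeasure_G_Ioc[of 0 1, simplified, symmetric] by (rule emeasure_mono) auto
  finally show ?thesis .
qed

text \<open>The integrand of the energy is c times the derivative of v, so the integral is c times
  the total increment of v. If c is nonzero, square integrability makes G of finite measure, v
  vanishes at both ends and the increment is 0. The second claim is the contrapositive of the first
  half of this argument.\<close>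

lemma Fse_energy_eq_0:
  assumes v: "v \<in> Fse s" and u: "integrable lebesgue (\<lambda>x. (deriv u x)\<^sup>2)"
    and c: "AE x in lebesgue. x \<in> G \<longrightarrow> deriv u x = c"
    and um: "deriv u \<in> borel_measurable lebesgue"
  shows "energy u v = 0" "emeasure lborel G = \<infinity> \<Longrightarrow> c = 0"
proof -
  obtain g where m[measurable]: "g \<in> borel_measurable borel" and g2: "integrable lborel (\<lambda>x. indicator G x * (g x)\<^sup>2)"
    and vd: "\<And>a b. a \<le> b \<Longrightarrow> v b - v a = (LINT x|lborel. indicator {a<..b} x * (indicator G x * g x))"
    and vg: "AE x in lebesgue. (v has_real_derivative indicator G x * g x) (at x)"
    and top: "\<not> filterlim s at_top at_top \<Longrightarrow> (v \<longlongrightarrow> 0) at_top"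
    and bot: "\<not> filterlim s at_bot at_bot \<Longrightarrow> (v \<longlongrightarrow> 0) at_bot"
    using FseD[OF v] by blast
  let ?k = "\<lambda>x. indicator G x * g x :: real"
  have fin: "emeasure lborel G < \<infinity>" if "c \<noteq> 0"
  proof -
    have "integrable lebesgue (\<lambda>x. indicator G x * c\<^sup>2)"
    proof (rule Bochner_Integration.integrable_bound[OF u])
      show "(\<lambda>x. indicator G x * c\<^sup>2) \<in> borel_measurable lebesgue" by (intro measurable_completion) simp
      show "AE x in lebesgue. norm (indicator G x * c\<^sup>2) \<le> norm ((deriv u x)\<^sup>2)"
        using c by eventually_elim (auto split: split_indicator)
    qed
    then have "integrable lborel (\<lambda>x. indicator G x * c\<^sup>2)" by (simp add: integrable_completion)
    then have "integrable lborel (\<lambda>x. (indicator G x * c\<^sup>2) / c\<^sup>2)" by (rule integrable_divide_zero)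
    then have "integrable lborel (indicator G :: real \<Rightarrow> real)" using that by simp
    then show ?thesis by (simp add: integrable_indicator_iff)
  qed
  then show "emeasure lborel G = \<infinity> \<Longrightarrow> c = 0" by fastforce
  have ae: "AE x in lebesgue. deriv u x * deriv v x = c * ?k x"
    using c vg by eventually_elim (auto dest!: DERIV_imp_deriv split: split_indicator)
  have m1: "(\<lambda>x. c * ?k x) \<in> borel_measurable lborel" by simp
  \<comment> \<open>Measurability of \<open>deriv v\<close> is not part of \<open>Fse\<close>; it
    comes from almost everywhere equality with a Borel function and the completeness of Lebesgue
    measure.\<close>
  have m2: "(\<lambda>x. deriv u x * deriv v x) \<in> borel_measurable lebesgue"
    by (rule borel_measurable_AE[OF measurable_completion[OF m1]]) (use ae in \<open>simp add: eq_commute\<close>)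
  have "(LINT x|lebesgue. deriv u x * deriv v x) = (LINT x|lebesgue. c * ?k x)"
    by (rule integral_cong_AE[OF m2 measurable_completion[OF m1] ae])
  also have "\<dots> = (LINT x|lborel. c * ?k x)" by (rule integral_completion[OF m1])
  also have "\<dots> = c * (LINT x|lborel. ?k x)" by simp
  also have "\<dots> = 0"
  proof (cases "c = 0")
    case False
    note fin = fin[OF False]
    have k: "integrable lborel ?k" using L2_integrable_on[OF m _ g2, of UNIV] fin by simp
    have "(v \<longlongrightarrow> 0) at_top" "(v \<longlongrightarrow> 0) at_bot" using top bot fin emeasure_G_infinite_iff by auto
    \<comment> \<open>The same sequence of increments over (-n, n] is evaluated twice: by the
      boundary values of v and by dominated convergence.\<close>
    then have "(\<lambda>n. v (real n) - v (- real n)) \<longlonglongrightarrow> 0 - 0"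
      by (intro tendsto_diff; elim filterlim_compose)
        (auto intro: filterlim_real_sequentially filterlim_compose[OF filterlim_uminus_at_bot_at_top filterlim_real_sequentially])
    moreover have "(\<lambda>n. v (real n) - v (- real n)) \<longlonglongrightarrow> (LINT x|lborel. ?k x)"
    proof -
      have "(\<lambda>n. LINT x|lborel. indicator {- real n<..real n} x * ?k x) \<longlonglongrightarrow> (LINT x|lborel. ?k x)"
      proof (rule integral_dominated_convergence)
        show "integrable lborel (\<lambda>x. norm (?k x))" using k by simp
        show "AE x in lborel. (\<lambda>n. indicator {- real n<..real n} x * ?k x) \<longlonglongrightarrow> ?k x"
        proof (intro AE_I2 tendsto_eventually)
          fix x
          obtain N where N: "\<bar>x\<bar> < real N" using reals_Archimedean2 by blast
          show "eventually (\<lambda>n. indicator {- real n<..real n} x * ?k x = ?k x) sequentially"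
            using eventually_ge_at_top[of N]
          proof eventually_elim
            case (elim n)
            then have "real N \<le> real n" by simp
            then show ?case using N by (auto split: split_indicator)
          qed
        qed
      qed (auto split: split_indicator)
      then show ?thesis by (simp add: vd)
    qed
    ultimately show ?thesis using LIMSEQ_unique by fastforce
  qed simp
  finally show "energy u v = 0" by (simp add: energy_def)
qed

text \<open>The primitive is based at an end where it has to vanish, if there is one, because g is
  integrable over G near such an end. If both ends impose a condition, the vanishing mean supplies
  the second one.\<close>

lemma Fse_primitive:
  assumes m[measurable]: "g \<in> borel_measurable borel"
    and g2: "integrable lborel (\<lambda>x. indicator G x * (g x)\<^sup>2)"
    and mean: "emeasure lborel G < \<infinity> \<Longrightarrow> (LINT x|lborel. indicator G x * g x) = 0"
  shows "\<exists>v \<in> Fse s. AE x in lebesgue. (v has_real_derivative indicator G x * g x) (at x)"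
proof -
  let ?k = "\<lambda>x. indicator G x * g x :: real"
  let ?int = "\<lambda>A. integrable lborel (\<lambda>t. indicator A t * ?k t)"
  have "\<exists>v. (\<forall>a b. a \<le> b \<longrightarrow> v b - v a = (LINT x|lborel. indicator {a<..b} x * ?k x)) \<and>
    (\<not> filterlim s at_top at_top \<longrightarrow> (v \<longlongrightarrow> 0) at_top) \<and> (\<not> filterlim s at_bot at_bot \<longrightarrow> (v \<longlongrightarrow> 0) at_bot)"
  proof -
    consider "\<not> filterlim s at_bot at_bot" | "filterlim s at_bot at_bot" "\<not> filterlim s at_top at_top"
      | "filterlim s at_bot at_bot" "filterlim s at_top at_top" by blast
    then show ?thesis
    proof cases
      case 1
      have int: "?int {..x}" for x
        using emeasure_G_left[of x] 1 by (intro L2_integrable_on g2 m) (auto simp: less_top)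
      define v where "v x = (LINT t|lborel. indicator {..x} t * ?k t)" for x
      have "v b - v a = (LINT x|lborel. indicator {a<..b} x * ?k x)" if "a \<le> b" for a b
        unfolding v_def using that
        by (subst Bochner_Integration.integral_diff[symmetric])
          (auto intro!: int Bochner_Integration.integral_cong split: split_indicator)
      moreover have "(v \<longlongrightarrow> 0) at_bot"
      proof -
        \<comment> \<open>The limit at minus infinity is taken along -r, so that dominated
          convergence at plus infinity applies.\<close>
        have "((\<lambda>r. LINT t|lborel. indicator {..- r} t * ?k t) \<longlongrightarrow> integral\<^sup>L lborel (\<lambda>t::real. 0 :: real)) at_top"
        proof (rule integral_dominated_convergence_at_top[where s="\<lambda>r t. indicator {..- r} t * ?k t" and f="\<lambda>_. 0"])
          show "integrable lborel (\<lambda>t. norm (indicator {..0} t * ?k t))" using int[of 0] by (rule integrable_norm)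
          show "AE x in lborel. ((\<lambda>r. indicator {..- r} x * ?k x) \<longlongrightarrow> 0) at_top"
          proof (intro AE_I2 tendsto_eventually)
            fix x show "eventually (\<lambda>r. indicator {..- r} x * ?k x = 0) at_top"
              using eventually_gt_at_top[of "- x"] by eventually_elim auto
          qed
          show "\<forall>\<^sub>F r in at_top. AE x in lborel. norm (indicator {..- r} x * ?k x) \<le> norm (indicator {..0} x * ?k x)"
            using eventually_ge_at_top[of "0 :: real"]
            by eventually_elim (auto intro!: AE_I2 split: split_indicator)
        qed auto
        then show ?thesis by (simp add: v_def filterlim_at_bot_mirror)
      qed
      moreover have "(v \<longlongrightarrow> 0) at_top" if "\<not> filterlim s at_top at_top"
      proof -
        \<comment> \<open>Both ends are now bounded, so v tends to the integral over all of G, which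
          is 0 by \<open>mean\<close>.\<close>
        have fin: "emeasure lborel G < \<infinity>" using 1 that emeasure_G_infinite_iff by (simp add: less_top)
        then have "integrable lborel ?k" using L2_integrable_on[OF m _ g2, of UNIV] by simp
        from tendsto_integral_at_top[OF _ this] show ?thesis by (simp add: v_def[abs_def] mean[OF fin])
      qed
      ultimately show ?thesis by blast
    next
      case 2
      have int: "?int {x<..}" for x
        using emeasure_G_right[of x] 2 by (intro L2_integrable_on g2 m) (auto simp: less_top)
      define v where "v x = - (LINT t|lborel. indicator {x<..} t * ?k t)" for x
      have "v b - v a = (LINT x|lborel. indicator {a<..b} x * ?k x)" if "a \<le> b" for a b
      proof -
        have "v b - v a = (LINT t|lborel. indicator {a<..} t * ?k t) - (LINT t|lborel. indicator {b<..} t * ?k t)"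
          by (simp add: v_def)
        also have "\<dots> = (LINT x|lborel. indicator {a<..b} x * ?k x)"
          using that by (subst Bochner_Integration.integral_diff[symmetric])
            (auto intro!: int Bochner_Integration.integral_cong split: split_indicator)
        finally show ?thesis .
      qed
      moreover have "(v \<longlongrightarrow> 0) at_top"
      proof -
        have "((\<lambda>r. LINT t|lborel. indicator {r<..} t * ?k t) \<longlongrightarrow> integral\<^sup>L lborel (\<lambda>t::real. 0 :: real)) at_top"
        proof (rule integral_dominated_convergence_at_top[where s="\<lambda>r t. indicator {r<..} t * ?k t" and f="\<lambda>_. 0"])
          show "integrable lborel (\<lambda>t. norm (indicator {0<..} t * ?k t))" using int[of 0] by (rule integrable_norm)
          show "AE x in lborel. ((\<lambda>r. indicator {r<..} x * ?k x) \<longlongrightarrow> 0) at_top"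
          proof (intro AE_I2 tendsto_eventually)
            fix x show "eventually (\<lambda>r. indicator {r<..} x * ?k x = 0) at_top"
              using eventually_gt_at_top[of x] by eventually_elim auto
          qed
          show "\<forall>\<^sub>F r in at_top. AE x in lborel. norm (indicator {r<..} x * ?k x) \<le> norm (indicator {0<..} x * ?k x)"
            using eventually_ge_at_top[of "0 :: real"]
            by eventually_elim (auto intro!: AE_I2 split: split_indicator)
        qed auto
        then have "(v \<longlongrightarrow> - 0) at_top" unfolding v_def[abs_def] by (intro tendsto_minus) simp
        then show ?thesis by simp
      qed
      ultimately show ?thesis using 2 by blast
    next
      case 3
      have int: "?int {a<..b}" for a b
        using emeasure_G_bounded(1) by (intro L2_integrable_on g2 m) auto
      \<comment> \<open>With infinite mass on both sides g need not be integrable near either end,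
        so the base point is 0; the subtracted term is the signed integral for negative x.\<close>
      define v where "v x = (LINT t|lborel. indicator {0<..x} t * ?k t) - (LINT t|lborel. indicator {x<..0} t * ?k t)" for x
      have "v b - v a = (LINT x|lborel. indicator {a<..b} x * ?k x)" if "a \<le> b" for a b
      proof -
        have "(LINT t|lborel. indicator {0<..b} t * ?k t) + (LINT t|lborel. indicator {a<..0} t * ?k t) =
          (LINT t|lborel. indicator {0<..a} t * ?k t) + (LINT t|lborel. indicator {b<..0} t * ?k t) + (LINT x|lborel. indicator {a<..b} x * ?k x)"
          using that by (simp only: Bochner_Integration.integral_add[symmetric] Bochner_Integration.integrable_add int)
            (intro Bochner_Integration.integral_cong refl, auto split: split_indicator)
        then show ?thesis by (simp add: v_def)
      qed
      then show ?thesis using 3 by blast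
    qed
  qed
  then obtain v where v: "\<And>a b. a \<le> b \<Longrightarrow> v b - v a = (LINT x|lborel. indicator {a<..b} x * ?k x)"
    "\<not> filterlim s at_top at_top \<Longrightarrow> (v \<longlongrightarrow> 0) at_top" "\<not> filterlim s at_bot at_bot \<Longrightarrow> (v \<longlongrightarrow> 0) at_bot" by blast
  from FseI[OF m g2 v] AE_derivative_of_density[OF m g2 v(1)] show ?thesis by blast
qed

section \<open>Identification of the orthogonal space\<close>

lemma Fe_borel_deriv:
  assumes "u \<in> Fe"
  obtains f where "f \<in> borel_measurable borel" "AE x in lebesgue. deriv u x = f x" "integrable lborel (\<lambda>x. (f x)\<^sup>2)"
proof -
  have u: "deriv u \<in> borel_measurable lebesgue" "integrable lebesgue (\<lambda>x. (deriv u x)\<^sup>2)"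
    using assms by (auto simp: Fe_def)
  \<comment> \<open>\<open>deriv u\<close> is only Lebesgue measurable, whereas
    \<open>is_ds_density\<close> asks for a Borel function.\<close>
  obtain f where m[measurable]: "f \<in> borel_measurable lborel" and f: "AE x in lborel. deriv u x = f x"
    using completion_ex_borel_measurable_real[OF u(1)] by blast
  have f': "AE x in lebesgue. deriv u x = f x" using f by (rule AE_completion)
  have "integrable lebesgue (\<lambda>x. (f x)\<^sup>2)"
  proof (rule integrable_cong_AE_imp[OF u(2)])
    show "(\<lambda>x. (f x)\<^sup>2) \<in> borel_measurable lebesgue" by (rule measurable_completion) simp
    show "AE x in lebesgue. (deriv u x)\<^sup>2 = (f x)\<^sup>2" using f' by eventually_elim simp
  qed
  then have "integrable lborel (\<lambda>x. (f x)\<^sup>2)" by (simp add: integrable_completion)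
  moreover have "f \<in> borel_measurable borel" using m by simp
  ultimately show ?thesis using that f' by blast
qed

text \<open>If G has finite measure, c must be the mean of f over G, so that the primitive of
  f - c over G vanishes at both ends; otherwise square integrability on G forces c = 0.\<close>
lemma Fse_component:
  assumes m[measurable]: "f \<in> borel_measurable borel" and f2: "integrable lborel (\<lambda>x. (f x)\<^sup>2)"
  obtains c v where "v \<in> Fse s" "AE x in lebesgue. (v has_real_derivative indicator G x * (f x - c)) (at x)"
    "integrable lborel (\<lambda>x. indicator G x * (f x - c)\<^sup>2)"
    "(LINT x|lborel. f x * (indicator G x * (f x - c))) = (LINT x|lborel. indicator G x * (f x - c)\<^sup>2)"
proof -
  have Gf2: "integrable lborel (\<lambda>x. indicator G x * (f x)\<^sup>2)"
    by (rule Bochner_Integration.integrable_bound[OF f2]) (auto split: split_indicator)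
  define c where "c = (if emeasure lborel G < \<infinity> then (LINT x|lborel. indicator G x * f x) / measure lborel G else 0)"
  have 1: "integrable lborel (\<lambda>x. indicator G x * (f x - c)\<^sup>2)
    \<and> (emeasure lborel G < \<infinity> \<longrightarrow> (LINT x|lborel. indicator G x * (f x - c)) = 0)
    \<and> (LINT x|lborel. f x * (indicator G x * (f x - c))) = (LINT x|lborel. indicator G x * (f x - c)\<^sup>2)"
  proof (cases "emeasure lborel G < \<infinity>")
    case True
    have i: "integrable lborel (\<lambda>x. indicator G x * f x)"
      using L2_integrable_on[OF m _ Gf2, of UNIV] True by simp
    have j: "integrable lborel (indicator G :: real \<Rightarrow> real)" using True by (intro integrable_real_indicator) auto
    have "measure lborel G > 0" using emeasure_G_pos True by (simp add: measure_def enn2real_positive_iff)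
    moreover have mean: "(LINT x|lborel. indicator G x * (f x - c)) = (LINT x|lborel. indicator G x * f x) - measure lborel G * c"
      using i j by (simp add: right_diff_distrib)
    ultimately have 0: "(LINT x|lborel. indicator G x * (f x - c)) = 0" using True by (simp add: c_def)
    have eq: "indicator G x * (f x - c)\<^sup>2 = indicator G x * (f x)\<^sup>2 - 2 * c * (indicator G x * f x) + c\<^sup>2 * indicator G x" for x
      by (simp add: power2_eq_square algebra_simps)
    have sq: "integrable lborel (\<lambda>x. indicator G x * (f x - c)\<^sup>2)"
      unfolding eq using i j Gf2 by simp
    have "integrable lborel (\<lambda>x. indicator G x * (f x - c))" using i j by (simp add: right_diff_distrib)
    \<comment> \<open>Writing f as (f - c) + c leaves the square plus c times a function of integral
      0. This is why testing u against its own component returns a squared norm.\<close>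
    moreover have "f x * (indicator G x * (f x - c)) = indicator G x * (f x - c)\<^sup>2 + c * (indicator G x * (f x - c))" for x
      by (simp add: power2_eq_square algebra_simps)
    ultimately show ?thesis using sq 0 by simp
  next
    case False
    then have "c = 0" by (simp add: c_def)
    then show ?thesis using Gf2 False by (simp add: power2_eq_square mult.left_commute)
  qed
  then obtain v where "v \<in> Fse s" "AE x in lebesgue. (v has_real_derivative indicator G x * (f x - c)) (at x)"
    using Fse_primitive[of "\<lambda>x. f x - c"] by auto
  with 1 show ?thesis by (intro that) auto
qed

lemma Gs_eq: "Gs s = {u \<in> Fe. \<exists>c. AE x in lebesgue. x \<in> G \<longrightarrow> deriv u x = c}"
proof (intro equalityI subsetI)
  fix u assume "u \<in> {u \<in> Fe. \<exists>c. AE x in lebesgue. x \<in> G \<longrightarrow> deriv u x = c}"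
  then show "u \<in> Gs s" using Fse_energy_eq_0(1) by (auto simp: Gs_def Fe_def)
next
  fix u assume u: "u \<in> Gs s"
  then have Fe: "u \<in> Fe" by (simp add: Gs_def)
  then obtain f where m[measurable]: "f \<in> borel_measurable borel" and uf: "AE x in lebesgue. deriv u x = f x"
    and f2: "integrable lborel (\<lambda>x. (f x)\<^sup>2)"
    by (rule Fe_borel_deriv)
  obtain c v where v: "v \<in> Fse s" "AE x in lebesgue. (v has_real_derivative indicator G x * (f x - c)) (at x)"
    and sq: "integrable lborel (\<lambda>x. indicator G x * (f x - c)\<^sup>2)"
    and eq: "(LINT x|lborel. f x * (indicator G x * (f x - c))) = (LINT x|lborel. indicator G x * (f x - c)\<^sup>2)"
    using Fse_component[OF m f2] by blast
  have ae: "AE x in lebesgue. deriv u x * deriv v x = f x * (indicator G x * (f x - c))"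
    using uf v(2) by eventually_elim (simp add: DERIV_imp_deriv)
  have m1: "(\<lambda>x. f x * (indicator G x * (f x - c))) \<in> borel_measurable lborel" by simp
  have m2: "(\<lambda>x. deriv u x * deriv v x) \<in> borel_measurable lebesgue"
    by (rule borel_measurable_AE[OF measurable_completion[OF m1]]) (use ae in \<open>simp add: eq_commute\<close>)
  have "0 = (LINT x|lebesgue. deriv u x * deriv v x)" using u v(1) by (auto simp: Gs_def energy_def)
  also have "\<dots> = (LINT x|lborel. indicator G x * (f x - c)\<^sup>2)"
    unfolding eq[symmetric] integral_completion[OF m1, symmetric]
    by (rule integral_cong_AE[OF m2 measurable_completion[OF m1] ae])
  finally have "AE x in lborel. indicator G x * (f x - c)\<^sup>2 = 0"
    using integral_nonneg_eq_0_iff_AE[OF sq] by simp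
  then have "AE x in lebesgue. indicator G x * (f x - c)\<^sup>2 = 0" by (rule AE_completion)
  with uf have "AE x in lebesgue. x \<in> G \<longrightarrow> deriv u x = c"
    by eventually_elim auto
  then show "u \<in> {u \<in> Fe. \<exists>c. AE x in lebesgue. x \<in> G \<longrightarrow> deriv u x = c}" using Fe by blast
qed

text \<open>A dummy test function for \<open>Fse_energy_eq_0\<close> when only its statement about c
  is wanted.\<close>

lemma Fse_zero: "(\<lambda>x. 0) \<in> Fse s"
  by (rule FseI[of "\<lambda>_. 0"]) auto

lemma Gs_eq_infinite:
  assumes "emeasure lborel G = \<infinity>"
  shows "Gs s = {u \<in> Fe. AE x in lebesgue. x \<in> G \<longrightarrow> deriv u x = 0}"
proof -
  have "c = 0" if "u \<in> Fe" "AE x in lebesgue. x \<in> G \<longrightarrow> deriv u x = c" for u c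
    by (rule Fse_energy_eq_0(2)[OF Fse_zero _ that(2) _ assms]) (use that(1) in \<open>auto simp: Fe_def\<close>)
  then show ?thesis unfolding Gs_eq by blast
qed

section \<open>Existence of the decomposition\<close>

lemma Fse_abs_cont_id:
  assumes "v \<in> Fse s"
  shows "abs_cont_wrt id v"
  unfolding abs_cont_wrt_alt
proof (intro allI impI)
  fix a b \<epsilon> :: real assume e: "\<epsilon> > 0"
  have ac: "abs_cont_wrt s v" using assms by (simp add: Fse_def)
  obtain \<delta> where \<delta>: "\<delta> > 0" "\<And>n x y. nonoverlapping a b n x y \<Longrightarrow> (\<Sum>i<n. s (y i) - s (x i)) < \<delta> \<Longrightarrow>
       (\<Sum>i<n. \<bar>v (y i) - v (x i)\<bar>) < \<epsilon>"
    using abs_cont_wrtD[OF ac e, of a b] by blast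
  have "(\<Sum>i<n. s (y i) - s (x i)) \<le> (\<Sum>i<n. id (y i) - id (x i))" if "nonoverlapping a b n x y" for n x y
    using that by (intro sum_mono) (auto simp: nonoverlapping_def intro!: s_lipschitz)
  with \<delta> show "\<exists>\<delta>>0. \<forall>n x y. nonoverlapping a b n x y \<longrightarrow> (\<Sum>i<n. id (y i) - id (x i)) < \<delta> \<longrightarrow>
     (\<Sum>i<n. \<bar>v (y i) - v (x i)\<bar>) < \<epsilon>" by (meson le_less_trans)
qed

lemma Fe_decomposition:
  assumes u: "u \<in> Fe"
  shows "\<exists>u1 u2. u1 \<in> Fse s \<and> u2 \<in> Gs s \<and> u = (\<lambda>x. u1 x + u2 x)"
proof -
  obtain f where m[measurable]: "f \<in> borel_measurable borel" and uf: "AE x in lebesgue. deriv u x = f x"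
    and f2: "integrable lborel (\<lambda>x. (f x)\<^sup>2)"
    using Fe_borel_deriv[OF u] by blast
  obtain c v where v: "v \<in> Fse s" "AE x in lebesgue. (v has_real_derivative indicator G x * (f x - c)) (at x)"
    and sq: "integrable lborel (\<lambda>x. indicator G x * (f x - c)\<^sup>2)"
    using Fse_component[OF m f2] by blast
  define w where "w x = u x - v x" for x
  \<comment> \<open>The derivative of the remainder: f off G and the constant c on G.\<close>
  define h where "h x = f x - indicator G x * (f x - c)" for x
  have hm[measurable]: "h \<in> borel_measurable lborel" unfolding h_def by simp
  have uac: "abs_cont_wrt id u" using u by (simp add: Fe_def)
  have ac: "abs_cont_wrt id w"
    unfolding w_def by (rule abs_cont_wrt_diff[OF uac Fse_abs_cont_id[OF v(1)]])
  \<comment> \<open>Equality of \<open>deriv u\<close> and f says nothing at points where u has no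
    derivative, so differentiability of u is brought in as a separate fact.\<close>
  have wh: "AE x in lebesgue. deriv w x = h x"
    using uf v(2) abs_cont_AE_differentiable[OF uac]
  proof eventually_elim
    case (elim x)
    have "(u has_real_derivative deriv u x) (at x)"
      using elim(3) by (simp add: DERIV_deriv_iff_real_differentiable)
    then have "(w has_real_derivative deriv u x - indicator G x * (f x - c)) (at x)"
      unfolding w_def using elim(2) by (rule DERIV_diff)
    then show ?case using elim(1) by (simp add: DERIV_imp_deriv h_def)
  qed
  have "integrable lborel (\<lambda>x. (h x)\<^sup>2)"
  proof (rule Bochner_Integration.integrable_bound)
    show "integrable lborel (\<lambda>x. 2 * (f x)\<^sup>2 + 2 * (indicator G x * (f x - c)\<^sup>2))" using f2 sq by simp
    \<comment> \<open>Here s and t are arbitrary numbers, not the scale function; the bound is the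
      nonnegativity of (s + t)^2.\<close>
    have "(s - t)\<^sup>2 \<le> 2 * s\<^sup>2 + 2 * t\<^sup>2" for s t :: real
      using zero_le_power2[of "s + t"] unfolding power2_sum power2_diff by simp
    from this[of "f x" "f x - c" for x]
    show "AE x in lborel. norm ((h x)\<^sup>2) \<le> norm (2 * (f x)\<^sup>2 + 2 * (indicator G x * (f x - c)\<^sup>2))"
      by (intro AE_I2) (auto simp: h_def split: split_indicator)
  qed simp
  then have h2: "integrable lebesgue (\<lambda>x. (h x)\<^sup>2)" by (simp add: integrable_completion)
  have wm: "deriv w \<in> borel_measurable lebesgue"
    by (rule borel_measurable_AE[OF measurable_completion[OF hm]]) (use wh in \<open>simp add: eq_commute\<close>)
  have "integrable lebesgue (\<lambda>x. (deriv w x)\<^sup>2)"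
    using wh by (intro integrable_cong_AE_imp[OF h2]) (use wm in \<open>auto elim: eventually_mono\<close>)
  then have "w \<in> Fe" using ac wm by (simp add: Fe_def)
  moreover have "AE x in lebesgue. x \<in> G \<longrightarrow> deriv w x = c"
    using wh by eventually_elim (simp add: h_def)
  ultimately have "w \<in> Gs s" unfolding Gs_eq by blast
  then show ?thesis using v(1) by (intro exI[of _ v] exI[of _ w]) (auto simp: w_def)
qed

section \<open>Uniqueness of the decomposition\<close>

lemma decomposition_diff:
  assumes Fse: "u1 \<in> Fse s" "v1 \<in> Fse s" and Gs: "u2 \<in> Gs s" "v2 \<in> Gs s"
    and eq: "(\<lambda>x. u1 x + u2 x) = (\<lambda>x. v1 x + v2 x)"
  obtains c d where "\<And>x. u1 x - v1 x = c * s x + d" "emeasure lborel G = \<infinity> \<Longrightarrow> c = 0"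
proof -
  obtain g where g[measurable]: "g \<in> borel_measurable borel" "integrable lborel (\<lambda>x. indicator G x * (g x)\<^sup>2)"
    and u1: "\<And>a b. a \<le> b \<Longrightarrow> u1 b - u1 a = (LINT x|lborel. indicator {a<..b} x * (indicator G x * g x))"
      "AE x in lebesgue. (u1 has_real_derivative indicator G x * g x) (at x)"
      "\<not> filterlim s at_top at_top \<Longrightarrow> (u1 \<longlongrightarrow> 0) at_top"
      "\<not> filterlim s at_bot at_bot \<Longrightarrow> (u1 \<longlongrightarrow> 0) at_bot"
    using FseD[OF Fse(1)] by blast
  obtain h where h[measurable]: "h \<in> borel_measurable borel" "integrable lborel (\<lambda>x. indicator G x * (h x)\<^sup>2)"
    and v1: "\<And>a b. a \<le> b \<Longrightarrow> v1 b - v1 a = (LINT x|lborel. indicator {a<..b} x * (indicator G x * h x))"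
      "AE x in lebesgue. (v1 has_real_derivative indicator G x * h x) (at x)"
      "\<not> filterlim s at_top at_top \<Longrightarrow> (v1 \<longlongrightarrow> 0) at_top"
      "\<not> filterlim s at_bot at_bot \<Longrightarrow> (v1 \<longlongrightarrow> 0) at_bot"
    using FseD[OF Fse(2)] by blast
  have Fe: "u2 \<in> Fe" "v2 \<in> Fe" using Gs by (auto simp: Gs_def)
  obtain c1 where c1: "AE x in lebesgue. x \<in> G \<longrightarrow> deriv u2 x = c1" using Gs(1) unfolding Gs_eq by blast
  obtain c2 where c2: "AE x in lebesgue. x \<in> G \<longrightarrow> deriv v2 x = c2" using Gs(2) unfolding Gs_eq by blast
  have u2: "AE x in lebesgue. u2 differentiable (at x)" and v2: "AE x in lebesgue. v2 differentiable (at x)"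
    using Fe by (auto simp: Fe_def intro: abs_cont_AE_differentiable)
  \<comment> \<open>Equality of the sums gives u1 - v1 = v2 - u2, and the right side has derivative
    c2 - c1 on G.\<close>
  define c where "c = c2 - c1"
  from u1(2) v1(2) c1 c2 u2 v2 have "AE x in lebesgue. indicator G x * (g x - h x) = indicator G x * c"
  proof eventually_elim
    case (elim x)
    have "((\<lambda>x. u1 x + u2 x) has_real_derivative indicator G x * g x + deriv u2 x) (at x)"
      using elim(1,5) by (intro DERIV_add) (auto simp: DERIV_deriv_iff_real_differentiable)
    moreover have "((\<lambda>x. v1 x + v2 x) has_real_derivative indicator G x * h x + deriv v2 x) (at x)"
      using elim(2,6) by (intro DERIV_add) (auto simp: DERIV_deriv_iff_real_differentiable)
    ultimately have "indicator G x * g x + deriv u2 x = indicator G x * h x + deriv v2 x"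
      unfolding eq by (rule DERIV_unique)
    then show ?case using elim(3,4) by (auto simp: c_def split: split_indicator)
  qed
  then have ae: "AE x in lborel. indicator G x * (g x - h x) = indicator G x * c"
    by (simp add: AE_completion_iff)
  have incr: "(u1 b - v1 b) - (u1 a - v1 a) = c * (s b - s a)" if "a \<le> b" for a b
  proof -
    let ?I = "indicator {a<..b} :: real \<Rightarrow> real"
    have "(u1 b - v1 b) - (u1 a - v1 a) = (LINT x|lborel. ?I x * (indicator G x * g x)) - (LINT x|lborel. ?I x * (indicator G x * h x))"
      using u1(1)[OF that] v1(1)[OF that] by linarith
    also have "\<dots> = (LINT x|lborel. ?I x * (indicator G x * (g x - h x)))"
      by (subst Bochner_Integration.integral_diff[symmetric])
        \<comment> \<open>Each density is integrable on a bounded interval because the part of G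
          inside it has finite measure.\<close>
        (auto intro!: L2_integrable_on g(2) h(2) emeasure_G_bounded simp: right_diff_distrib simp flip: infinity_ennreal_def)
    also have "\<dots> = (LINT x|lborel. c * indicator (G \<inter> {a<..b}) x)"
    proof (rule integral_cong_AE)
      show "AE x in lborel. ?I x * (indicator G x * (g x - h x)) = c * indicator (G \<inter> {a<..b}) x"
        using ae by eventually_elim (auto split: split_indicator)
    qed auto
    also have "\<dots> = c * (s b - s a)"
      using emeasure_G_Ioc[OF that] s_le[OF that] by (simp add: measure_def)
    finally show ?thesis .
  qed
  show ?thesis
  proof (rule that[of c "u1 0 - v1 0 - c * s 0"])
    show "u1 x - v1 x = c * s x + (u1 0 - v1 0 - c * s 0)" for x
      using incr[of 0 x] incr[of x 0] by (cases "0 \<le> x") (auto simp: algebra_simps)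
    assume inf: "emeasure lborel G = \<infinity>"
    show "c = 0"
      using Fse_energy_eq_0(2)[OF Fse(1) _ c1 _ inf] Fse_energy_eq_0(2)[OF Fse(1) _ c2 _ inf] Fe
      by (simp add: c_def Fe_def)
  qed
qed

lemma decomposition_unique_transient:
  assumes tr: "s_transient s" and Fse: "u1 \<in> Fse s" "v1 \<in> Fse s" and Gs: "u2 \<in> Gs s" "v2 \<in> Gs s"
    and eq: "(\<lambda>x. u1 x + u2 x) = (\<lambda>x. v1 x + v2 x)"
  shows "u1 = v1 \<and> u2 = v2"
proof -
  obtain c d where w: "\<And>x. u1 x - v1 x = c * s x + d" and inf: "emeasure lborel G = \<infinity> \<Longrightarrow> c = 0"
    using decomposition_diff[OF Fse Gs eq] by blast
  have top: "((\<lambda>x. c * s x + d) \<longlongrightarrow> 0) at_top" if "\<not> filterlim s at_top at_top"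
    using tendsto_diff[of u1 0 at_top v1 0] that Fse by (simp add: Fse_def w)
  have bot: "((\<lambda>x. c * s x + d) \<longlongrightarrow> 0) at_bot" if "\<not> filterlim s at_bot at_bot"
    using tendsto_diff[of u1 0 at_bot v1 0] that Fse by (simp add: Fse_def w)
  \<comment> \<open>If G has finite measure, c s + d tends to 0 at both ends, so its increments over
    [-x, x] tend to 0. These increments are monotone in x up to sign, hence at least as large as the
    one over [0, 1], where s strictly increases.\<close>
  have c: "c = 0"
  proof (cases "emeasure lborel G = \<infinity>")
    case False
    then have "((\<lambda>x. c * s x + d) \<longlongrightarrow> 0) at_top" "((\<lambda>x. c * s x + d) \<longlongrightarrow> 0) at_bot"
      using top bot emeasure_G_infinite_iff by auto
    then have "((\<lambda>x. (c * s x + d) - (c * s (- x) + d)) \<longlongrightarrow> 0 - 0) at_top"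
      by (intro tendsto_diff) (auto simp: filterlim_at_bot_mirror)
    then have lim: "((\<lambda>x. \<bar>c * (s x - s (- x))\<bar>) \<longlongrightarrow> 0) at_top"
      using tendsto_rabs_zero by (fastforce simp: algebra_simps)
    have "\<bar>c * (s 1 - s 0)\<bar> \<le> 0"
    proof (rule tendsto_lowerbound[OF lim])
      show "\<forall>\<^sub>F x in at_top. \<bar>c * (s 1 - s 0)\<bar> \<le> \<bar>c * (s x - s (- x))\<bar>"
        using eventually_ge_at_top[of 1]
      proof eventually_elim
        case (elim x)
        have "s 1 \<le> s x" "s (- x) \<le> s 0" "s 0 \<le> s 1" using elim by (auto intro: s_le)
        then show ?case unfolding abs_mult by (intro mult_left_mono) auto
      qed
    qed simp
    moreover have "s 0 < s 1" using s_mono by (simp add: strict_mono_def)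
    ultimately show ?thesis by simp
  qed (rule inf)
  \<comment> \<open>Transience provides at least one end at which the remaining constant must tend
    to 0.\<close>
  have "d = 0"
    using tr top bot unfolding s_transient_def c by (auto simp: tendsto_const_iff)
  then have "u1 x = v1 x" for x using w[of x] c by simp
  moreover have "u2 x = v2 x" for x using fun_cong[OF eq, of x] \<open>u1 x = v1 x\<close> by simp
  ultimately show ?thesis by auto
qed

text \<open>Here G has infinite measure, which removes the multiple of s; with no boundary condition
  at either end, the additive constant d remains.\<close>

lemma decomposition_unique_recurrent:
  assumes re: "s_recurrent s" and Fse: "u1 \<in> Fse s" "v1 \<in> Fse s" and Gs: "u2 \<in> Gs s" "v2 \<in> Gs s"
    and eq: "(\<lambda>x. u1 x + u2 x) = (\<lambda>x. v1 x + v2 x)"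
  shows "\<exists>c. v1 = (\<lambda>x. u1 x + c) \<and> v2 = (\<lambda>x. u2 x - c)"
proof -
  have "emeasure lborel G = \<infinity>" using re emeasure_G_infinite_iff by (simp add: s_recurrent_def)
  then obtain d where w: "\<And>x. u1 x - v1 x = d"
    using decomposition_diff[OF Fse Gs eq] by (metis add_0 mult_zero_left)
  have "v1 x = u1 x + - d" "v2 x = u2 x - - d" for x
    using w[of x] fun_cong[OF eq, of x] by auto
  then show ?thesis by blast
qed

end

theorem mainTheorem8:
  fixes s :: "real \<Rightarrow> real" and G :: "real set"
  assumes s_mono: "strict_mono s"
    and s_ac: "abs_cont_wrt id s"
    and s_deriv: "AE x in lebesgue. (s has_real_derivative indicator G x) (at x)"
    and G_open: "open G"
    and F_pos: "emeasure lebesgue (- G) > 0"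
    and F_perfect: "\<forall>x \<in> - G. x islimpt (- G)"
  shows "Gs s = {u \<in> Fe. \<exists>c. AE x in lebesgue. x \<in> G \<longrightarrow> deriv u x = c} \<and>
    (emeasure lebesgue G = \<infinity> \<longleftrightarrow> (filterlim s at_bot at_bot \<or> filterlim s at_top at_top)) \<and>
    (emeasure lebesgue G = \<infinity> \<longrightarrow>
           Gs s = {u \<in> Fe. AE x in lebesgue. x \<in> G \<longrightarrow> deriv u x = 0}) \<and>
    (\<forall>u \<in> Fe. \<exists>u1 u2. u1 \<in> Fse s \<and> u2 \<in> Gs s \<and> u = (\<lambda>x. u1 x + u2 x)) \<and>
    (s_transient s \<longrightarrow>
           (\<forall>u1 u2 v1 v2. u1 \<in> Fse s \<and> u2 \<in> Gs s \<and> v1 \<in> Fse s \<and> v2 \<in> Gs s \<and>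
              (\<lambda>x. u1 x + u2 x) = (\<lambda>x. v1 x + v2 x) \<longrightarrow> u1 = v1 \<and> u2 = v2)) \<and>
    (s_recurrent s \<longrightarrow>
           (\<forall>u1 u2 v1 v2. u1 \<in> Fse s \<and> u2 \<in> Gs s \<and> v1 \<in> Fse s \<and> v2 \<in> Gs s \<and>
              (\<lambda>x. u1 x + u2 x) = (\<lambda>x. v1 x + v2 x) \<longrightarrow>
              (\<exists>c. v1 = (\<lambda>x. u1 x + c) \<and> v2 = (\<lambda>x. u2 x - c))))"
proof -
  interpret unit_scale s G by unfold_locales (fact s_mono s_ac s_deriv G_open)+
  have "emeasure lebesgue G = emeasure lborel G" by simp
  then show ?thesis
    using Gs_eq emeasure_G_infinite_iff Gs_eq_infinite Fe_decomposition
      decomposition_unique_transient decomposition_unique_recurrent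
    by (intro conjI) (simp, simp, simp, blast+)
qed

end
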